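(* Let $\Omega$ be a slice domain in $\mathbb{H}$ and let $f:\Omega\to\mathbb{H}$ be a slice regular function. Fix a $2$-sphere $S=x_0+y_0\mathbb{S}$ (with $x_0,y_0\in\mathbb{R}$ and $y_0>0$) that intersects $\Omega$, set $$\mathcal{O}(S)=\{q\in S\cap\Omega: f^\circ_s(q)\neq0\ \text{or}\ f'_s(q)\neq0\},$$ and consider the slice domain $\Omega'=\Omega\setminus\mathcal{O}(S)$. Then there exists a slice regular function $h:\Omega'\to\mathbb{H}$ such that $$f(q)=[(q-x_0)^2+y_0^2]*h(q)=[(q-x_0)^2+y_0^2]\,h(q)$$ throughout $\Omega'$. Moreover, $h$ cannot be continuously extended to any open set intersecting $\mathcal{O}(S)$.
   Context: $\mathbb{H}$ is the real algebra of quaternions, $\mathbb{S}=\{J\in\mathbb{H}:J^2=-1\}$, $x+y\mathbb{S}=\{x+yJ:J\in\mathbb{S}\}$, $L_I=\mathbb{R}+I\mathbb{R}$ and $T_I=T\cap L_I$ for $I\in\mathbb{S}$, $T\subseteq\mathbb{H}$. For $q=x+yI$ ($x,y\in\mathbb{R}$, $I\in\mathbb{S}$), $\operatorname{Im}(q)=yI$. A domain is a nonempty open connected set; a slice domain is a domain $\Omega\subseteq\mathbb{H}$ with $\Omega\cap\mathbb{R}\neq\emptyset$ such that $\Omega_I$ is a domain of $L_I$ for every $I\in\mathbb{S}$. A function $f:\Omega\to\mathbb{H}$ is slice regular if, for every $I\in\mathbb{S}$, the restriction $f_I$ of $f$ to $\Omega_I$ has continuous partial derivatives and $\frac12\left(\frac{\partial}{\partial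 x}+I\frac{\partial}{\partial y}\right)f_I(x+yI)\equiv0$. Spherical value and derivative: for a slice regular $f$ on a slice domain $\Omega$ and $p_0=x_0+y_0I_0\in\Omega\setminus\mathbb{R}$ ($y_0>0$, $I_0\in\mathbb{S}$), it is known that there exist a neighborhood $U\subseteq\Omega$ of $p_0$ in $x_0+y_0\mathbb{S}$ and unique quaternions $b(p_0),c(p_0)$ (independent of $U$) with $f(x_0+y_0I)=b(p_0)+I\,c(p_0)$ for all $x_0+y_0I\in U$. Set $f^\circ_s(p_0)=b(p_0)$ and $f'_s(p_0)=y_0^{-1}c(p_0)$; for $p_0\in\Omega\cap\mathbb{R}$ set $f^\circ_s(p_0)=f(p_0)$. Regular product: for $q\in\Omega\setminus\mathbb{R}$, $(f*g)(q)=f^\circ_s(q)g^\circ_s(q)+\operatorname{Im}(q)^2f'_s(q)g'_s(q)+\operatorname{Im}(q)\big(f^\circ_s(q)g'_s(q)+f'_s(q)g^\circ_s(q)\big)$, and $(f*g)(q)=f(q)g(q)$ for $q\in\Omega\cap\mathbb{R}$. An expression such as $[(q-x_0)^2+y_0^2]*h(q)$ means the regular product of the polynomial function $q\mapsto(q-x_0)^2+y_0^2$ and $h$, evaluated at $q$. *)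

theory Defs
  imports "HOL-Analysis.Analysis"
begin

section \<open>The real algebra of quaternions\<close>

codatatype quat = Quat (qRe: real) (qI: real) (qJ: real) (qK: real)

lemma quat_eq_iff: "p = q \<longleftrightarrow> qRe p = qRe q \<and> qI p = qI q \<and> qJ p = qJ q \<and> qK p = qK q"
  by (auto intro: quat.expand)

instantiation quat :: real_vector
begin

primcorec zero_quat where
  "qRe 0 = 0" | "qI 0 = 0" | "qJ 0 = 0" | "qK 0 = 0"

primcorec plus_quat where
  "qRe (p + q) = qRe p + qRe q" | "qI (p + q) = qI p + qI q"
| "qJ (p + q) = qJ p + qJ q" | "qK (p + q) = qK p + qK q"

primcorec uminus_quat where
  "qRe (- p) = - qRe p" | "qI (- p) = - qI p" | "qJ (- p) = - qJ p" | "qK (- p) = - qK p"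

primcorec minus_quat where
  "qRe (p - q) = qRe p - qRe q" | "qI (p - q) = qI p - qI q"
| "qJ (p - q) = qJ p - qJ q" | "qK (p - q) = qK p - qK q"

primcorec scaleR_quat where
  "qRe (r *\<^sub>R q) = r * qRe q" | "qI (r *\<^sub>R q) = r * qI q"
| "qJ (r *\<^sub>R q) = r * qJ q" | "qK (r *\<^sub>R q) = r * qK q"

instance
  by standard (auto simp: quat_eq_iff algebra_simps)

end

instantiation quat :: real_algebra_1
begin

primcorec one_quat where
  "qRe 1 = 1" | "qI 1 = 0" | "qJ 1 = 0" | "qK 1 = 0"

primcorec times_quat where
  "qRe (p * q) = qRe p * qRe q - qI p * qI q - qJ p * qJ q - qK p * qK q"
| "qI (p * q) = qRe p * qI q + qI p * qRe q + qJ p * qK q - qK p * qJ q"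
| "qJ (p * q) = qRe p * qJ q - qI p * qK q + qJ p * qRe q + qK p * qI q"
| "qK (p * q) = qRe p * qK q + qI p * qJ q - qJ p * qI q + qK p * qRe q"

instance
  by standard (auto simp: quat_eq_iff algebra_simps)

end

instantiation quat :: real_inner
begin

definition "inner p q = qRe p * qRe q + qI p * qI q + qJ p * qJ q + qK p * qK q" for p q :: quat
definition "norm q = sqrt ((qRe q)\<^sup>2 + (qI q)\<^sup>2 + (qJ q)\<^sup>2 + (qK q)\<^sup>2)" for q :: quat
definition "sgn q = q /\<^sub>R norm q" for q :: quat
definition "dist p q = norm (p - q)" for p q :: quat
definition [code del]:
  "(uniformity :: (quat \<times> quat) filter) = (INF e\<in>{0 <..}. principal {(x, y). dist x y < e})"
definition [code del]:
  "open (U :: quat set) \<longleftrightarrow> (\<forall>x\<in>U. eventually (\<lambda>(x', y). x' = x \<longrightarrow> y \<in> U) uniformity)"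

instance
proof
  fix p q r :: quat and c :: real
  show "inner p q = inner q p" "inner (p + q) r = inner p r + inner q r"
    "inner (c *\<^sub>R p) q = c * inner p q" "0 \<le> inner p p"
    by (auto simp: inner_quat_def algebra_simps)
  show "inner p p = 0 \<longleftrightarrow> p = 0"
  proof
    assume "inner p p = 0"
    then have "(qRe p)\<^sup>2 + (qI p)\<^sup>2 + (qJ p)\<^sup>2 + (qK p)\<^sup>2 = 0"
      by (simp add: inner_quat_def power2_eq_square)
    then show "p = 0"
      by (simp add: quat_eq_iff add_nonneg_eq_0_iff)
  qed (simp add: inner_quat_def)
  show "norm p = sqrt (inner p p)"
    by (simp add: norm_quat_def inner_quat_def power2_eq_square)
qed (fact sgn_quat_def dist_quat_def uniformity_quat_def open_quat_def)+

end

instantiation quat :: real_normed_div_algebra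
begin

definition "inverse q = Quat (qRe q) (- qI q) (- qJ q) (- qK q) /\<^sub>R (norm q)\<^sup>2" for q :: quat
definition "divide p q = p * inverse q" for p q :: quat

instance
proof
  fix p q :: quat
  have n: "(norm q)\<^sup>2 = qRe q * qRe q + qI q * qI q + qJ q * qJ q + qK q * qK q" for q :: quat
    by (simp add: norm_quat_def power2_eq_square)
  show "norm (p * q) = norm p * norm q"
    by (rule power2_eq_imp_eq) (simp_all add: power_mult_distrib n algebra_simps)
  show "p div q = p * inverse q"
    by (fact divide_quat_def)
  show "inverse (0::quat) = 0"
    by (simp add: inverse_quat_def quat_eq_iff)
  assume "p \<noteq> 0"
  then have N: "(norm p)\<^sup>2 \<noteq> 0"
    by simp
  define r where "r = Quat (qRe p) (- qI p) (- qJ p) (- qK p)"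
  have "r * p = (norm p)\<^sup>2 *\<^sub>R 1" "p * r = (norm p)\<^sup>2 *\<^sub>R 1"
    by (simp_all add: quat_eq_iff r_def n)
  with N show "inverse p * p = 1" "p * inverse p = 1"
    by (simp_all add: inverse_quat_def r_def [symmetric])
qed

end

section \<open>Slice domains and slice regular functions\<close>

definition imag_units :: "quat set" where
  "imag_units = {J. J\<^sup>2 = - 1}"

definition qsphere :: "real \<Rightarrow> real \<Rightarrow> quat set" where
  "qsphere x y = {of_real x + of_real y * J | J. J \<in> imag_units}"

definition slice_plane :: "quat \<Rightarrow> quat set" where
  "slice_plane I = {of_real x + I * of_real y | x y. True}"

definition qIm :: "quat \<Rightarrow> quat" where
  "qIm q = q - of_real (qRe q)"

definition slice_domain :: "quat set \<Rightarrow> bool" where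
  "slice_domain \<Omega> \<longleftrightarrow>
     open \<Omega> \<and> connected \<Omega> \<and> \<Omega> \<inter> \<real> \<noteq> {} \<and>
     (\<forall>I\<in>imag_units. openin (top_of_set (slice_plane I)) (\<Omega> \<inter> slice_plane I) \<and>
        connected (\<Omega> \<inter> slice_plane I) \<and> \<Omega> \<inter> slice_plane I \<noteq> {})"

text \<open>
  Functions on \<open>\<Omega>\<close> are modelled by total functions of which only the values on \<open>\<Omega>\<close> matter;
  \<open>fx\<close> and \<open>fy\<close> are the partial derivatives of \<open>(x, y) \<mapsto> f (x + yI)\<close>.
\<close>

definition slice_regular :: "quat set \<Rightarrow> (quat \<Rightarrow> quat) \<Rightarrow> bool" where
  "slice_regular \<Omega> f \<longleftrightarrow>
     (\<forall>I\<in>imag_units. \<exists>fx fy :: real \<times> real \<Rightarrow> quat.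
        let D = {(x, y). of_real x + of_real y * I \<in> \<Omega>} in
          continuous_on D fx \<and> continuous_on D fy \<and>
          (\<forall>(x, y)\<in>D.
             ((\<lambda>t. f (of_real t + of_real y * I)) has_vector_derivative fx (x, y)) (at x) \<and>
             ((\<lambda>t. f (of_real x + of_real t * I)) has_vector_derivative fy (x, y)) (at y) \<and>
             (1 / 2) *\<^sub>R (fx (x, y) + I * fy (x, y)) = 0))"

section \<open>Spherical value and spherical derivative\<close>

text \<open>
  For non-real \<open>p\<close>, the unique \<open>y > 0\<close> with \<open>p \<in> qsphere x y\<close> is \<open>norm (qIm p)\<close>, and \<open>x = qRe p\<close>.
\<close>

definition has_spherical_coeffs :: "quat set \<Rightarrow> (quat \<Rightarrow> quat) \<Rightarrow> quat \<Rightarrow> quat \<Rightarrow> quat \<Rightarrow> bool" where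
  "has_spherical_coeffs \<Omega> f p b c \<longleftrightarrow>
     (let x = qRe p; y = norm (qIm p) in
        \<exists>U. openin (top_of_set (qsphere x y)) U \<and> p \<in> U \<and> U \<subseteq> \<Omega> \<and>
          (\<forall>I\<in>imag_units. of_real x + of_real y * I \<in> U \<longrightarrow>
             f (of_real x + of_real y * I) = b + I * c))"

definition spherical_coeffs :: "quat set \<Rightarrow> (quat \<Rightarrow> quat) \<Rightarrow> quat \<Rightarrow> quat \<times> quat" where
  "spherical_coeffs \<Omega> f p = (THE (b, c). has_spherical_coeffs \<Omega> f p b c)"

definition spherical_value :: "quat set \<Rightarrow> (quat \<Rightarrow> quat) \<Rightarrow> quat \<Rightarrow> quat" where
  "spherical_value \<Omega> f p = (if p \<in> \<real> then f p else fst (spherical_coeffs \<Omega> f p))"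

text \<open>Only meaningful at non-real points.\<close>

definition spherical_deriv :: "quat set \<Rightarrow> (quat \<Rightarrow> quat) \<Rightarrow> quat \<Rightarrow> quat" where
  "spherical_deriv \<Omega> f p = snd (spherical_coeffs \<Omega> f p) /\<^sub>R norm (qIm p)"

definition regular_product :: "quat set \<Rightarrow> (quat \<Rightarrow> quat) \<Rightarrow> (quat \<Rightarrow> quat) \<Rightarrow> quat \<Rightarrow> quat" where
  "regular_product \<Omega> f g q =
     (if q \<in> \<real> then f q * g q
      else spherical_value \<Omega> f q * spherical_value \<Omega> g q
         + (qIm q)\<^sup>2 * spherical_deriv \<Omega> f q * spherical_deriv \<Omega> g q
         + qIm q * (spherical_value \<Omega> f q * spherical_deriv \<Omega> g q
                    + spherical_deriv \<Omega> f q * spherical_value \<Omega> g q))"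

definition singular_part :: "quat set \<Rightarrow> (quat \<Rightarrow> quat) \<Rightarrow> quat set \<Rightarrow> quat set" where
  "singular_part \<Omega> f S =
     {q \<in> S \<inter> \<Omega>. spherical_value \<Omega> f q \<noteq> 0 \<or> spherical_deriv \<Omega> f q \<noteq> 0}"

end

theory Submission
  imports Defs "HOL-Complex_Analysis.Conformal_Mappings"
begin

text \<open>
  Left multiplication by an imaginary unit \<open>I\<close> makes the quaternions a complex vector space, and
  slice regularity of \<open>f\<close> means that \<open>x + iy \<mapsto> f (x + yI)\<close> is holomorphic for this structure, for
  every \<open>I\<close>. Composition with complex linear functionals brings in complex function theory.

  The first step is the local representation formula, which says that \<open>f (x + yI) = b + Ic\<close> with
  \<open>b\<close> and \<open>c\<close> independent of \<open>I\<close>, for \<open>I\<close> near a given unit (\<open>local_slice_formula\<close>). Two imaginary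
  units \<open>J\<close> and \<open>K\<close> determine candidates for \<open>b\<close> and \<open>c\<close>; the resulting function \<open>b + Ic\<close> is again
  holomorphic for \<open>I\<close> (\<open>left_holomorphic_two_slices\<close>), so the identity theorem propagates the
  formula from the real axis, where it is trivial, along the connected slice. Hence the spherical
  coefficients exist, are unique and are locally constant on each sphere. The singular part of
  the sphere is therefore closed in \<open>\<Omega>\<close>, and removing it leaves a slice domain because each slice
  loses at most two points.

  Outside the singular part, \<open>f\<close> vanishes at the points of the sphere. These are simple zeros of
  \<open>P(q) = (q - x\<^sub>0)\<^sup>2 + y\<^sub>0\<^sup>2\<close> on every slice, so \<open>h = f / P\<close> extends holomorphically across them on
  every slice (\<open>left_holomorphic_sphere_quotient\<close>). The coefficients of \<open>P\<close> are real, so the regular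
  product \<open>P * h\<close> is the pointwise one. Near every point of the singular part there is a point
  of it at which \<open>f\<close> is not zero, because \<open>b + Ic\<close> has at most one zero \<open>I\<close> unless \<open>b = c = 0\<close>.
  At such a point \<open>P h = f\<close> excludes a continuous extension of \<open>h\<close>, since \<open>P\<close> vanishes there.
\<close>

section \<open>Imaginary units and the complex slices\<close>

lemma quat_of_real_sel [simp]:
  "qRe (of_real r) = r" "qI (of_real r) = 0" "qJ (of_real r) = 0" "qK (of_real r) = 0"
  by (simp_all add: of_real_def)

lemma of_real_mult_quat: "of_real r * q = r *\<^sub>R q" for q :: quat
  by (simp add: of_real_def)

lemma of_real_commute_quat: "q * of_real r = of_real r * q" for q :: quat
  by (simp add: of_real_def)

lemma norm_quat_sq: "(norm q)\<^sup>2 = (qRe q)\<^sup>2 + (qI q)\<^sup>2 + (qJ q)\<^sup>2 + (qK q)\<^sup>2"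
  by (simp add: norm_quat_def)

lemma imag_units_iff: "I \<in> imag_units \<longleftrightarrow> qRe I = 0 \<and> norm I = 1"
proof
  assume "I \<in> imag_units"
  then have *: "I * I = -1"
    by (simp add: imag_units_def power2_eq_square)
  then have e: "qRe (I * I) = -1" "qI (I * I) = 0" "qJ (I * I) = 0" "qK (I * I) = 0"
    by simp_all
  have "qRe I = 0"
  proof (rule ccontr)
    assume "qRe I \<noteq> 0"
    with e have "qI I = 0" "qJ I = 0" "qK I = 0"
      by auto
    with e(1) have "(qRe I)\<^sup>2 = -1"
      by (simp add: power2_eq_square)
    then show False
      by (metis neg_0_le_iff_le not_one_le_zero zero_le_power2)
  qed
  moreover have "norm I * norm I = 1"
    using * by (metis norm_minus_cancel norm_mult norm_one)
  then have "norm I = 1"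
    by (simp add: square_eq_1_iff) (use norm_ge_zero[of I] in linarith)
  ultimately show "qRe I = 0 \<and> norm I = 1"
    by simp
next
  assume a: "qRe I = 0 \<and> norm I = 1"
  then have "(qI I)\<^sup>2 + (qJ I)\<^sup>2 + (qK I)\<^sup>2 = 1"
    using norm_quat_sq[of I] by simp
  with a show "I \<in> imag_units"
    by (simp add: imag_units_def quat_eq_iff power2_eq_square)
qed

lemma imag_unitsD:
  assumes "I \<in> imag_units"
  shows "qRe I = 0" "norm I = 1" "I * I = -1" "I * (I * q) = - q" "I \<noteq> 0"
proof -
  show *: "I * I = -1"
    using assms by (simp add: imag_units_def power2_eq_square)
  show "qRe I = 0" "norm I = 1"
    using assms by (simp_all add: imag_units_iff)
  then show "I \<noteq> 0"
    by auto
  show "I * (I * q) = - q"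
    by (simp add: mult.assoc[symmetric] *)
qed

lemma imag_units_uminus: "I \<in> imag_units \<Longrightarrow> - I \<in> imag_units"
  by (simp add: imag_units_iff)

lemma imag_units_Quat: "Quat 0 1 0 0 \<in> imag_units" "Quat 0 0 1 0 \<in> imag_units"
  by (simp_all add: imag_units_iff norm_quat_def)

text \<open>
  No imaginary unit is isolated. An imaginary unit \<open>J\<close> not commuting with \<open>I\<close> exists, and
  conjugating \<open>I\<close> by \<open>1 + tJ\<close> with small \<open>t\<close> moves it slightly.
\<close>

lemma imag_units_nearby:
  assumes I: "I \<in> imag_units" and "e > 0"
  obtains J where "J \<in> imag_units" "J \<noteq> I" "norm (J - I) < e"
proof -
  obtain J where J: "J \<in> imag_units" "I * J \<noteq> J * I"
  proof (cases "I * Quat 0 1 0 0 = Quat 0 1 0 0 * I")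
    case True
    then have "I * Quat 0 0 1 0 \<noteq> Quat 0 0 1 0 * I"
      using imag_unitsD(1,5)[OF I] by (auto simp: quat_eq_iff)
    then show thesis
      using that imag_units_Quat by blast
  qed (use that imag_units_Quat in blast)
  define u where "u = (\<lambda>t. 1 + of_real t * J)"
  have "qRe (u t) = 1" for t
    by (simp add: u_def imag_unitsD(1)[OF J(1)])
  then have u0: "u t \<noteq> 0" for t
    by (metis zero_neq_one zero_quat.sel(1))
  define c where "c = (\<lambda>t. inverse (u t) * I * u t)"
  have "((\<lambda>t. c t) \<longlongrightarrow> inverse (1 + of_real 0 * J) * I * (1 + of_real 0 * J)) (at 0)"
    unfolding c_def u_def by (rule tendsto_intros refl | simp)+
  then have "(c \<longlongrightarrow> I) (at 0)"
    by simp
  then have "eventually (\<lambda>t. dist (c t) I < e) (at 0)"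
    using \<open>e > 0\<close> by (rule tendstoD)
  then obtain d where d: "d > 0" "\<And>t. t \<noteq> 0 \<Longrightarrow> dist t 0 < d \<Longrightarrow> dist (c t) I < e"
    by (auto simp: eventually_at)
  define t where "t = d / 2"
  have t: "t \<noteq> 0" "dist t 0 < d"
    using d(1) by (auto simp: t_def)
  show thesis
  proof (rule that)
    have "c t * c t = inverse (u t) * I * (u t * inverse (u t)) * I * u t"
      by (simp only: c_def mult.assoc)
    also have "\<dots> = inverse (u t) * (I * I) * u t"
      using u0[of t] by (simp add: mult.assoc)
    also have "\<dots> = -1"
      using u0[of t] imag_unitsD(3)[OF I] by simp
    finally show "c t \<in> imag_units"
      by (simp add: imag_units_def power2_eq_square)
    show "norm (c t - I) < e"
      using d(2)[OF t] by (simp add: dist_norm)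
    show "c t \<noteq> I"
    proof
      assume "c t = I"
      then have "u t * c t = u t * I"
        by simp
      moreover have "u t * c t = (u t * inverse (u t)) * I * u t"
        by (simp only: c_def mult.assoc)
      ultimately have "I * u t = u t * I"
        using u0[of t] by simp
      then have "t *\<^sub>R (I * J) = t *\<^sub>R (J * I)"
        by (simp add: u_def algebra_simps of_real_mult_quat)
      then show False
        using J(2) t(1) by simp
    qed
  qed
qed

text \<open>The embedding \<open>x + i y \<mapsto> x + y I\<close> of the complex plane onto the slice of \<open>I\<close>.\<close>

definition slice_embed :: "quat \<Rightarrow> complex \<Rightarrow> quat" where
  "slice_embed I z = of_real (Re z) + of_real (Im z) * I"

lemma slice_embed_of_real [simp]: "slice_embed I (of_real r) = of_real r"
  by (simp add: slice_embed_def)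

lemma slice_embed_0 [simp]: "slice_embed I 0 = 0"
  and slice_embed_1 [simp]: "slice_embed I 1 = 1"
  by (simp_all add: slice_embed_def)

lemma slice_embed_add: "slice_embed I (z + w) = slice_embed I z + slice_embed I w"
  and slice_embed_diff: "slice_embed I (z - w) = slice_embed I z - slice_embed I w"
  by (simp_all add: slice_embed_def algebra_simps)

lemma slice_embed_mult:
  "I \<in> imag_units \<Longrightarrow> slice_embed I (z * w) = slice_embed I z * slice_embed I w"
  by (simp add: slice_embed_def of_real_def algebra_simps imag_unitsD)

lemma bounded_linear_slice_embed: "bounded_linear (slice_embed I)"
proof -
  have "bounded_linear (\<lambda>z. Re z *\<^sub>R (1::quat) + Im z *\<^sub>R I)"
    by (intro bounded_linear_add bounded_linear_scaleR_const bounded_linear_Re bounded_linear_Im)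
  then show ?thesis
    by (simp add: slice_embed_def [abs_def] of_real_mult_quat of_real_def)
qed

lemma continuous_on_slice_embed [continuous_intros]:
  "continuous_on S g \<Longrightarrow> continuous_on S (\<lambda>x. slice_embed I (g x))"
  by (rule bounded_linear.continuous_on[OF bounded_linear_slice_embed])

lemma qRe_slice_embed: "I \<in> imag_units \<Longrightarrow> qRe (slice_embed I z) = Re z"
  by (simp add: slice_embed_def imag_unitsD)

lemma qIm_slice_embed: "I \<in> imag_units \<Longrightarrow> qIm (slice_embed I z) = of_real (Im z) * I"
  by (simp add: qIm_def qRe_slice_embed) (simp add: slice_embed_def)

lemma norm_slice_embed: "I \<in> imag_units \<Longrightarrow> norm (slice_embed I z) = norm z"
  by (rule power2_eq_imp_eq)
    (use norm_quat_sq[of I] imag_unitsD(1,2)[of I] in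
      \<open>simp_all add: norm_quat_sq cmod_power2 slice_embed_def power_mult_distrib add.assoc
        flip: distrib_left\<close>)

lemma inj_slice_embed: "I \<in> imag_units \<Longrightarrow> inj (slice_embed I)"
  by (rule injI) (metis norm_slice_embed slice_embed_diff norm_eq_zero eq_iff_diff_eq_0)

lemma slice_plane_eq_range: "slice_plane I = range (slice_embed I)"
proof -
  have "of_real x + I * of_real y = slice_embed I (Complex x y)" for x y
    by (simp add: slice_embed_def of_real_commute_quat)
  moreover have "slice_embed I z = of_real (Re z) + I * of_real (Im z)" for z
    by (simp add: slice_embed_def of_real_commute_quat)
  ultimately show ?thesis
    unfolding slice_plane_def by blast
qed

lemma quat_nonreal_in_slice:
  assumes "q \<notin> \<real>"
  obtains I x y where "I \<in> imag_units" "q = slice_embed I (Complex x y)" "y > 0"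
proof -
  have "qIm q \<noteq> 0"
    using assms unfolding qIm_def by (metis Reals_of_real eq_iff_diff_eq_0)
  then have n: "norm (qIm q) > 0"
    by simp
  define I where "I = qIm q /\<^sub>R norm (qIm q)"
  have "I \<in> imag_units"
    using n by (simp add: imag_units_iff I_def qIm_def)
  moreover have "q = slice_embed I (Complex (qRe q) (norm (qIm q)))"
    using n by (simp add: slice_embed_def I_def of_real_mult_quat) (simp add: qIm_def)
  ultimately show thesis
    using n by (rule that)
qed

lemma quat_in_slice:
  obtains I z where "I \<in> imag_units" "q = slice_embed I z"
proof (cases "q \<in> \<real>")
  case True
  then obtain r where "q = of_real r"
    by (auto elim: Reals_cases)
  then show thesis
    using that[OF imag_units_Quat(1), of "of_real r"] by simp
next
  case False
  then show thesis
    by (rule quat_nonreal_in_slice) (rule that)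
qed

lemma open_vimage_slice_embed: "open \<Omega> \<Longrightarrow> open (slice_embed I -` \<Omega>)"
  by (intro open_vimage continuous_on_slice_embed continuous_on_id)

text \<open>Since \<open>slice_embed I\<close> has a continuous left inverse, connectedness of a slice can be
  tested in the complex plane.\<close>

lemma connected_vimage_slice_embed_iff:
  assumes I: "I \<in> imag_units"
  shows "connected (slice_embed I -` \<Omega>) \<longleftrightarrow> connected (\<Omega> \<inter> slice_plane I)"
proof -
  define r where "r q = Complex (inner q 1) (inner q I)" for q
  have r: "r (slice_embed I z) = z" for z
    using norm_quat_sq[of I] imag_unitsD(1,2)[OF I]
    by (simp add: r_def complex_eq_iff inner_quat_def slice_embed_def power2_eq_square
        mult.assoc flip: distrib_left)
  have im: "\<Omega> \<inter> slice_plane I = slice_embed I ` (slice_embed I -` \<Omega>)"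
    unfolding slice_plane_eq_range by blast
  have "continuous_on UNIV r"
    unfolding r_def Complex_eq by (intro continuous_intros)
  moreover have "slice_embed I -` \<Omega> = r ` (\<Omega> \<inter> slice_plane I)"
    unfolding im image_image r by simp
  ultimately have "connected (\<Omega> \<inter> slice_plane I) \<Longrightarrow> connected (slice_embed I -` \<Omega>)"
    using connected_continuous_image continuous_on_subset by (metis top_greatest)
  moreover have "connected (slice_embed I -` \<Omega>) \<Longrightarrow> connected (\<Omega> \<inter> slice_plane I)"
    unfolding im
    by (intro connected_continuous_image continuous_on_slice_embed continuous_on_id)
  ultimately show ?thesis
    by blast
qed

section \<open>Left-holomorphic functions on a slice\<close>

text \<open>
  Left multiplication by \<open>I\<close> makes the quaternions a complex vector space;
  \<open>left_holomorphic I D g\<close> says that \<open>g\<close> is complex differentiable at each point of \<open>D\<close> for this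
  structure.
\<close>

definition left_holomorphic :: "quat \<Rightarrow> complex set \<Rightarrow> (complex \<Rightarrow> quat) \<Rightarrow> bool" where
  "left_holomorphic I D g \<longleftrightarrow>
     (\<forall>z\<in>D. \<exists>d. (g has_derivative (\<lambda>w. slice_embed I w * d)) (at z))"

text \<open>
  For each quaternion \<open>u\<close> a functional that is complex linear for this structure: its real part
  is the inner product with \<open>u\<close>, which forces the imaginary part. Jointly these
  functionals separate points, so statements about left-holomorphic functions reduce to
  statements about complex holomorphic ones.
\<close>

definition slice_functional :: "quat \<Rightarrow> quat \<Rightarrow> quat \<Rightarrow> complex" where
  "slice_functional I u q = Complex (inner q u) (inner q (I * u))"

lemma bounded_linear_slice_functional: "bounded_linear (slice_functional I u)"
proof -
  have "bounded_linear (\<lambda>q. inner q u *\<^sub>R 1 + inner q (I * u) *\<^sub>R \<i>)"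
    by (intro bounded_linear_add bounded_linear_scaleR_const bounded_linear_inner_left)
  moreover have "(\<lambda>q. inner q u *\<^sub>R 1 + inner q (I * u) *\<^sub>R \<i>) = slice_functional I u"
    by (auto simp: slice_functional_def complex_eq_iff)
  ultimately show ?thesis
    by simp
qed

lemma slice_functional_0 [simp]: "slice_functional I u 0 = 0"
  by (simp add: slice_functional_def complex_eq_iff)

lemma inner_imag_unit_mult:
  assumes "I \<in> imag_units"
  shows "inner (I * p) q = - inner p (I * q)"
  using imag_unitsD(1)[OF assms] by (simp add: inner_quat_def algebra_simps)

lemma slice_functional_mult:
  assumes I: "I \<in> imag_units"
  shows "slice_functional I u (slice_embed I w * q) = w * slice_functional I u q"
proof -
  have "slice_embed I w * q = Re w *\<^sub>R q + Im w *\<^sub>R (I * q)"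
    by (simp add: slice_embed_def of_real_mult_quat distrib_right)
  then show ?thesis
    by (simp add: slice_functional_def complex_eq_iff inner_add_left inner_imag_unit_mult[OF I]
        imag_unitsD(4)[OF I])
qed

lemma quat_eqI_slice_functional:
  assumes "\<And>u. slice_functional I u p = slice_functional I u q"
  shows "p = q"
proof -
  have "inner (p - q) (p - q) = 0"
    using assms[of "p - q"] by (simp add: slice_functional_def inner_diff_left)
  then show ?thesis
    by simp
qed

abbreviation "quat_basis \<equiv> [1, Quat 0 1 0 0, Quat 0 0 1 0, Quat 0 0 0 1]"

lemma quat_expand_slice_functional:
  "q = (\<Sum>u\<leftarrow>quat_basis. Re (slice_functional I u q) *\<^sub>R u)"
  by (simp add: slice_functional_def inner_quat_def quat_eq_iff)

lemma has_derivative_slice_functional: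
  assumes I: "I \<in> imag_units"
    and "(g has_derivative (\<lambda>w. slice_embed I w * d)) (at z)"
  shows "((\<lambda>z. slice_functional I u (g z)) has_field_derivative slice_functional I u d) (at z)"
proof -
  have "((\<lambda>z. slice_functional I u (g z)) has_derivative
      (\<lambda>w. slice_functional I u (slice_embed I w * d))) (at z)"
    by (rule bounded_linear.has_derivative[OF bounded_linear_slice_functional assms(2)])
  then show ?thesis
    by (simp add: slice_functional_mult[OF I] has_field_derivative_def 
        mult.commute[of _ "slice_functional I u d"])
qed

lemma left_holomorphic_iff:
  assumes I: "I \<in> imag_units" and D: "open D"
  shows "left_holomorphic I D g \<longleftrightarrow> (\<forall>u. (\<lambda>z. slice_functional I u (g z)) holomorphic_on D)"
    (is "?L \<longleftrightarrow> ?R")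
proof
  assume ?L
  then show ?R
    unfolding left_holomorphic_def holomorphic_on_open[OF D]
    using has_derivative_slice_functional[OF I] by meson
next
  assume R: ?R
  show ?L
    unfolding left_holomorphic_def
  proof
    fix z
    assume z: "z \<in> D"
    define F where "F u = (\<lambda>z. slice_functional I u (g z))" for u
    have F: "(F u has_derivative (\<lambda>w. deriv (F u) z * w)) (at z)" for u
      using holomorphic_derivI[of "F u" D z UNIV] R z D by (simp add: F_def has_field_derivative_def)
    define L where "L = (\<lambda>w. (\<Sum>u\<leftarrow>quat_basis. Re (deriv (F u) z * w) *\<^sub>R u))"
    have "((\<lambda>z. \<Sum>u\<leftarrow>quat_basis. Re (F u z) *\<^sub>R u) has_derivative L) (at z)"
      unfolding L_def list.map sum_list.Cons sum_list.Nil
      by (intro has_derivative_add has_derivative_const has_derivative_scaleR_left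
          bounded_linear.has_derivative[OF bounded_linear_Re] F)
    then have g: "(g has_derivative L) (at z)"
      by (simp only: F_def quat_expand_slice_functional[symmetric])
    \<comment> \<open>The functionals show that this real derivative is complex linear.\<close>
    have FL: "slice_functional I u (L w) = deriv (F u) z * w" for u w
    proof -
      have "(F u has_derivative (\<lambda>w. slice_functional I u (L w))) (at z)"
        unfolding F_def by (rule bounded_linear.has_derivative[OF bounded_linear_slice_functional g])
      from has_derivative_unique[OF this F] show ?thesis
        by metis
    qed
    have "L w = slice_embed I w * L 1" for w
      by (rule quat_eqI_slice_functional[of I]) (simp add: FL slice_functional_mult[OF I])
    then show "\<exists>d. (g has_derivative (\<lambda>w. slice_embed I w * d)) (at z)"
      using g by (metis (no_types, lifting) ext)
  qed
qed

lemma left_holomorphic_subset: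
  "left_holomorphic I D g \<Longrightarrow> E \<subseteq> D \<Longrightarrow> left_holomorphic I E g"
  by (auto simp: left_holomorphic_def)

lemma left_holomorphic_isCont:
  "left_holomorphic I D g \<Longrightarrow> z \<in> D \<Longrightarrow> isCont g z"
  unfolding left_holomorphic_def by (meson has_derivative_continuous)

text \<open>A function is left-holomorphic on a slice if and only if it has continuous partial
  derivatives satisfying the Cauchy--Riemann equation.\<close>

lemma slice_regular_imp_left_holomorphic:
  assumes "slice_regular \<Omega> f" "open \<Omega>" and I: "I \<in> imag_units"
  shows "left_holomorphic I (slice_embed I -` \<Omega>) (\<lambda>z. f (slice_embed I z))"
  unfolding left_holomorphic_def
proof
  fix z
  assume z: "z \<in> slice_embed I -` \<Omega>"
  define D where "D = {(x, y). of_real x + of_real y * I \<in> \<Omega>}"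
  obtain fx fy where "continuous_on D fy" and
    P: "\<And>x y. (x, y) \<in> D \<Longrightarrow>
      ((\<lambda>t. f (of_real t + of_real y * I)) has_vector_derivative fx (x, y)) (at x) \<and>
      ((\<lambda>t. f (of_real x + of_real t * I)) has_vector_derivative fy (x, y)) (at y) \<and>
      (1 / 2) *\<^sub>R (fx (x, y) + I * fy (x, y)) = 0"
    using assms(1) I unfolding slice_regular_def Let_def D_def by fast
  define a b where "a = Re z" and "b = Im z"
  have ab: "(a, b) \<in> D"
    using z by (simp add: D_def a_def b_def slice_embed_def)
  have "D = (\<lambda>p. of_real (fst p) + of_real (snd p) * I) -` \<Omega>"
    by (auto simp: D_def)
  also have "open \<dots>"
    by (intro open_vimage \<open>open \<Omega>\<close> continuous_intros)
  finally have oD: "open D" .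
  then obtain X Y where XY: "open X" "open Y" "a \<in> X" "b \<in> Y" "X \<times> Y \<subseteq> D"
    using ab open_prod_elim by (metis mem_Sigma_iff)
  obtain e where e: "e > 0" "ball b e \<subseteq> Y"
    using XY(2,4) openE by blast
  let ?Y = "ball b e"
  have sub: "X \<times> ?Y \<subseteq> D"
    using XY e by blast
  have "((\<lambda>(x, y). f (of_real x + of_real y * I)) has_derivative
      (\<lambda>(tx, ty). tx *\<^sub>R fx (a, b) + blinfun_apply (blinfun_scaleR_left (fy (a, b))) ty))
      (at (a, b) within X \<times> ?Y)"
  proof (rule has_derivative_partialsI)
    show "((\<lambda>x. f (of_real x + of_real b * I)) has_derivative (\<lambda>tx. tx *\<^sub>R fx (a, b)))
        (at a within X)"
      using P[OF ab] by (auto simp: has_vector_derivative_def intro: has_derivative_at_withinI)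
    show "((\<lambda>y. f (of_real x + of_real y * I)) has_derivative
        blinfun_apply (blinfun_scaleR_left (fy (x, y)))) (at y within ?Y)"
      if "x \<in> X" "y \<in> ?Y" for x y
      using P[of x y] subsetD[OF sub, of "(x, y)"] that
      by (auto simp: has_vector_derivative_def intro: has_derivative_at_withinI)
    have "continuous (at (a, b)) fy"
      using \<open>continuous_on D fy\<close> oD ab continuous_on_eq_continuous_at by blast
    then have "continuous (at (a, b)) (\<lambda>p. blinfun_scaleR_left (fy p))"
      by (rule bounded_linear.continuous[OF bounded_linear_blinfun_scaleR_left])
    then show "continuous (at (a, b) within X \<times> ?Y) (\<lambda>(x, y). blinfun_scaleR_left (fy (x, y)))"
      by (simp add: case_prod_unfold continuous_at_imp_continuous_at_within)
  qed (use e in auto)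
  moreover have "at (a, b) within X \<times> ?Y = at (a, b)"
    using XY e by (intro at_within_open open_Times) auto
  moreover have "fx (a, b) = - (I * fy (a, b))"
    using P[OF ab] by (simp add: eq_neg_iff_add_eq_0)
  then have "fy (a, b) = I * fx (a, b)"
    by (simp add: imag_unitsD(4)[OF I])
  ultimately have
    "((\<lambda>(x, y). f (of_real x + of_real y * I)) has_derivative
      (\<lambda>(tx, ty). tx *\<^sub>R fx (a, b) + ty *\<^sub>R (I * fx (a, b)))) (at (Re z, Im z))"
    by (simp add: a_def b_def)
  moreover have "((\<lambda>z. (Re z, Im z)) has_derivative (\<lambda>w. (Re w, Im w))) (at z)"
    by (intro has_derivative_Pair bounded_linear_imp_has_derivative bounded_linear_Re
        bounded_linear_Im)
  ultimately have "((\<lambda>(x, y). f (of_real x + of_real y * I)) \<circ> (\<lambda>z. (Re z, Im z)) has_derivative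
      (\<lambda>(tx, ty). tx *\<^sub>R fx (a, b) + ty *\<^sub>R (I * fx (a, b))) \<circ> (\<lambda>w. (Re w, Im w))) (at z)"
    by (rule diff_chain_at[rotated])
  then have "((\<lambda>z. f (slice_embed I z)) has_derivative (\<lambda>w. slice_embed I w * fx (a, b))) (at z)"
    by (simp add: o_def slice_embed_def distrib_right of_real_mult_quat)
  then show "\<exists>d. ((\<lambda>z. f (slice_embed I z)) has_derivative (\<lambda>w. slice_embed I w * d)) (at z)"
    by blast
qed

lemma left_holomorphic_imp_slice_regular:
  assumes "open \<Omega>"
    and "\<And>I. I \<in> imag_units \<Longrightarrow>
      left_holomorphic I (slice_embed I -` \<Omega>) (\<lambda>z. f (slice_embed I z))"
  shows "slice_regular \<Omega> f"
  unfolding slice_regular_def Let_def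
proof
  fix I
  assume I: "I \<in> imag_units"
  define E where "E = slice_embed I -` \<Omega>"
  have oE: "open E"
    unfolding E_def by (rule open_vimage_slice_embed[OF assms(1)])
  define g where "g = (\<lambda>z. f (slice_embed I z))"
  define D where "D = {(x, y). of_real x + of_real y * I \<in> \<Omega>}"
  have hol: "left_holomorphic I E g"
    using assms(2)[OF I] by (simp add: E_def g_def)
  then obtain d where d: "\<And>z. z \<in> E \<Longrightarrow> (g has_derivative (\<lambda>w. slice_embed I w * d z)) (at z)"
    unfolding left_holomorphic_def by metis
  have cu: "continuous_on E (\<lambda>z. slice_functional I u (d z))" for u
  proof -
    have "(\<lambda>z. slice_functional I u (g z)) holomorphic_on E"
      using hol left_holomorphic_iff[OF I oE] by blast
    then have "continuous_on E (deriv (\<lambda>z. slice_functional I u (g z)))"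
      using oE holomorphic_deriv holomorphic_on_imp_continuous_on by blast
    moreover have "deriv (\<lambda>z. slice_functional I u (g z)) z = slice_functional I u (d z)"
      if "z \<in> E" for z
      using has_derivative_slice_functional[OF I d[OF that]] by (rule DERIV_imp_deriv)
    ultimately show ?thesis
      by simp
  qed
  have "continuous_on E (\<lambda>z. \<Sum>u\<leftarrow>quat_basis. Re (slice_functional I u (d z)) *\<^sub>R u)"
    unfolding list.map sum_list.Cons sum_list.Nil by (intro continuous_intros cu)
  then have cd: "continuous_on E d"
    by (simp only: quat_expand_slice_functional[symmetric])
  have DE: "(x, y) \<in> D \<longleftrightarrow> Complex x y \<in> E" for x y
    by (simp add: D_def E_def slice_embed_def)
  have cD: "continuous_on D (\<lambda>(x, y). d (Complex x y))"
  proof -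
    have "continuous_on D (\<lambda>p. Complex (fst p) (snd p))"
      unfolding Complex_eq by (intro continuous_intros)
    moreover have "(\<lambda>p. Complex (fst p) (snd p)) ` D \<subseteq> E"
      using DE by auto
    ultimately have "continuous_on D (d \<circ> (\<lambda>p. Complex (fst p) (snd p)))"
      using cd continuous_on_compose continuous_on_subset by blast
    then show ?thesis
      by (simp add: o_def case_prod_unfold)
  qed
  have "((\<lambda>t. f (of_real t + of_real y * I)) has_vector_derivative d (Complex x y)) (at x)"
    "((\<lambda>t. f (of_real x + of_real t * I)) has_vector_derivative I * d (Complex x y)) (at y)"
    if xy: "(x, y) \<in> D" for x y
  proof -
    have g: "(g has_derivative (\<lambda>w. slice_embed I w * d (Complex x y))) (at (Complex x y))"
      using d DE xy by blast
    have hx: "((\<lambda>t. Complex t y) has_derivative (\<lambda>t. of_real t)) (at x)"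
      and hy: "((\<lambda>t. Complex x t) has_derivative (\<lambda>t. of_real t * \<i>)) (at y)"
      unfolding Complex_eq by (auto intro!: derivative_eq_intros simp: mult.commute)
    from diff_chain_at[OF hx g]
    show "((\<lambda>t. f (of_real t + of_real y * I)) has_vector_derivative d (Complex x y)) (at x)"
      by (simp add: has_vector_derivative_def o_def g_def slice_embed_def of_real_mult_quat)
    from diff_chain_at[OF hy g]
    show "((\<lambda>t. f (of_real x + of_real t * I)) has_vector_derivative I * d (Complex x y)) (at y)"
      by (simp add: has_vector_derivative_def o_def g_def slice_embed_def of_real_mult_quat)
  qed
  then have *: "\<forall>(x, y)\<in>D.
      ((\<lambda>t. f (of_real t + of_real y * I)) has_vector_derivative
         (\<lambda>(x, y). d (Complex x y)) (x, y)) (at x) \<and>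
      ((\<lambda>t. f (of_real x + of_real t * I)) has_vector_derivative
         (\<lambda>(x, y). I * d (Complex x y)) (x, y)) (at y) \<and>
      (1 / 2) *\<^sub>R ((\<lambda>(x, y). d (Complex x y)) (x, y) + I * (\<lambda>(x, y). I * d (Complex x y)) (x, y)) = 0"
    by (auto simp: imag_unitsD(4)[OF I])
  have "continuous_on D (\<lambda>(x, y). I * d (Complex x y))"
    using continuous_on_mult_left[OF cD, of I] by (simp add: case_prod_unfold)
  with cD * show "\<exists>fx fy. continuous_on {(x, y). of_real x + of_real y * I \<in> \<Omega>} fx \<and>
      continuous_on {(x, y). of_real x + of_real y * I \<in> \<Omega>} fy \<and>
      (\<forall>(x, y)\<in>{(x, y). of_real x + of_real y * I \<in> \<Omega>}.
         ((\<lambda>t. f (of_real t + of_real y * I)) has_vector_derivative fx (x, y)) (at x) \<and>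
         ((\<lambda>t. f (of_real x + of_real t * I)) has_vector_derivative fy (x, y)) (at y) \<and>
         (1 / 2) *\<^sub>R (fx (x, y) + I * fy (x, y)) = 0)"
    unfolding D_def[symmetric] by blast
qed

section \<open>The local representation formula\<close>

text \<open>
  If the values of \<open>b + Jc\<close> and \<open>b + Kc\<close> are known, then \<open>b + Ic\<close> is given by the formula below.
  It turns a function that is holomorphic for \<open>J\<close> and one that is holomorphic for \<open>K\<close>
  into one that is holomorphic for \<open>I\<close>.
\<close>

lemma left_holomorphic_two_slices:
  assumes I: "I \<in> imag_units" and J: "J \<in> imag_units" and K: "K \<in> imag_units" and "J \<noteq> K"
    and g: "left_holomorphic J D g" and h: "left_holomorphic K D h"
  shows "left_holomorphic I D (\<lambda>z. g z + (I - J) * (inverse (J - K) * (g z - h z)))"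
  unfolding left_holomorphic_def
proof
  fix z
  assume z: "z \<in> D"
  obtain d e where d: "(g has_derivative (\<lambda>w. slice_embed J w * d)) (at z)"
    and e: "(h has_derivative (\<lambda>w. slice_embed K w * e)) (at z)"
    using g h z unfolding left_holomorphic_def by blast
  define M where "M = inverse (J - K)"
  have M: "(J - K) * M = 1" "M * (J - K) = 1"
    using \<open>J \<noteq> K\<close> by (simp_all add: M_def)
  have J2: "J * J = -1" and K2: "K * K = -1"
    using J K by (simp_all add: imag_unitsD)
  \<comment> \<open>Since \<open>(J - K) J = - K (J - K)\<close>, the inverse of \<open>J - K\<close> intertwines \<open>J\<close> and \<open>- K\<close>.\<close>
  have "(J - K) * J = - (K * (J - K))" "(J - K) * K = - (J * (J - K))"
    by (simp_all add: algebra_simps J2 K2)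
  then have "M * ((J - K) * J) * M = - (M * (K * (J - K)) * M)"
    "M * ((J - K) * K) * M = - (M * (J * (J - K)) * M)"
    by simp_all
  moreover have "M * ((J - K) * J) * M = M * (J - K) * (J * M)"
    "M * (K * (J - K)) * M = M * K * ((J - K) * M)"
    "M * ((J - K) * K) * M = M * (J - K) * (K * M)"
    "M * (J * (J - K)) * M = M * J * ((J - K) * M)"
    by (simp_all only: mult.assoc)
  ultimately have MK: "M * K = - (J * M)" and MJ: "M * J = - (K * M)"
    by (simp_all add: M)
  define G where "G = d + (I - J) * (M * (d - e))"
  have GI: "J * d + (I - J) * (M * (J * d - K * e)) = I * G"
  proof -
    define p q where "p = M * d" and "q = M * e"
    have "(J - K) * (M * d) = d"
      using M(1) by (simp add: mult.assoc[symmetric])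
    then have d: "d = J * p - K * p"
      by (simp add: p_def left_diff_distrib)
    have "M * (J * d) = - (K * p)" "M * (K * e) = - (J * q)"
      using MJ MK by (simp_all add: p_def q_def mult.assoc[symmetric])
    then have "M * (J * d - K * e) = J * q - K * p"
      by (simp add: right_diff_distrib)
    moreover have "M * (d - e) = p - q"
      by (simp add: p_def q_def right_diff_distrib)
    moreover have "J * d = - p - J * (K * p)" "I * d = I * (J * p) - I * (K * p)"
      by (simp_all add: d right_diff_distrib imag_unitsD(4)[OF J])
    ultimately show ?thesis
      by (simp add: G_def ring_distribs right_diff_distrib left_diff_distrib mult.assoc
          imag_unitsD(4)[OF I] imag_unitsD(4)[OF J])
  qed
  have "slice_embed J w * d + (I - J) * (M * (slice_embed J w * d - slice_embed K w * e))
      = slice_embed I w * G" for w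
  proof -
    have "slice_embed J w * d + (I - J) * (M * (slice_embed J w * d - slice_embed K w * e))
       = Re w *\<^sub>R G + Im w *\<^sub>R (J * d + (I - J) * (M * (J * d - K * e)))"
      by (simp add: slice_embed_def G_def of_real_mult_quat algebra_simps)
    with GI show ?thesis
      by (simp add: slice_embed_def of_real_mult_quat distrib_right)
  qed
  moreover have "((\<lambda>z. g z + (I - J) * (M * (g z - h z))) has_derivative
      (\<lambda>w. slice_embed J w * d + (I - J) * (M * (slice_embed J w * d - slice_embed K w * e)))) (at z)"
    by (intro has_derivative_add has_derivative_diff has_derivative_mult_right d e)
  ultimately show "\<exists>d. ((\<lambda>z. g z + (I - J) * (inverse (J - K) * (g z - h z))) has_derivative
      (\<lambda>w. slice_embed I w * d)) (at z)"
    unfolding M_def by auto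
qed

text \<open>By the identity theorem, a relation \<open>f (x + yI) = b + Ic\<close> with \<open>b\<close> and \<open>c\<close> independent
  of \<open>I\<close> spreads from a set with a limit point to a whole domain.\<close>

lemma slice_formula_extends:
  assumes f: "slice_regular \<Omega> f" "open \<Omega>"
    and B: "open B" "connected B"
    and N: "N \<subseteq> imag_units" "\<And>I w. I \<in> N \<Longrightarrow> w \<in> B \<Longrightarrow> slice_embed I w \<in> \<Omega>"
    and X: "X \<subseteq> B" "\<xi> \<in> B" "\<xi> islimpt X"
    and formula: "\<And>w. w \<in> X \<Longrightarrow> \<exists>b c. \<forall>I\<in>N. f (slice_embed I w) = b + I * c"
    and w: "w \<in> B"
  shows "\<exists>b c. \<forall>I\<in>N. f (slice_embed I w) = b + I * c"
proof (cases "\<exists>J\<in>N. \<exists>K\<in>N. J \<noteq> K")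
  case False
  then have "\<forall>I\<in>N. f (slice_embed I w) = f (slice_embed (SOME J. J \<in> N) w) + I * 0"
    by (metis add_0_right mult_zero_right someI_ex)
  then show ?thesis
    by blast
next
  case True
  then obtain J K where JK: "J \<in> N" "K \<in> N" "J \<noteq> K"
    by blast
  have hol: "left_holomorphic I B (\<lambda>z. f (slice_embed I z))" if "I \<in> N" for I
    by (rule left_holomorphic_subset[OF slice_regular_imp_left_holomorphic[OF f]])
      (use that N in auto)
  define c where "c = (\<lambda>z. inverse (J - K) * (f (slice_embed J z) - f (slice_embed K z)))"
  have "f (slice_embed I w) = f (slice_embed J w) + (I - J) * c w" if I: "I \<in> N" for I
  proof (rule quat_eqI_slice_functional)
    fix u
    have uI: "I \<in> imag_units" "J \<in> imag_units" "K \<in> imag_units"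
      using I JK N by auto
    let ?G = "\<lambda>z. f (slice_embed J z) + (I - J) * c z"
    let ?p = "slice_functional I u"
    have "left_holomorphic I B ?G"
      unfolding c_def using uI JK hol by (intro left_holomorphic_two_slices) auto
    then have "(\<lambda>z. ?p (f (slice_embed I z)) - ?p (?G z)) holomorphic_on B"
      using hol[OF I] left_holomorphic_iff[OF uI(1) B(1)] by (auto intro: holomorphic_on_diff)
    moreover have "?p (f (slice_embed I z)) - ?p (?G z) = 0" if "z \<in> X" for z
    proof -
      obtain b c' where bc: "\<forall>I\<in>N. f (slice_embed I z) = b + I * c'"
        using formula \<open>z \<in> X\<close> by blast
      then have "c z = inverse (J - K) * ((J - K) * c')"
        using JK by (simp add: c_def left_diff_distrib)
      also have "\<dots> = c'"
        using JK by (simp add: mult.assoc[symmetric])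
      finally show ?thesis
        using bc I JK by (simp add: left_diff_distrib)
    qed
    ultimately have "?p (f (slice_embed I w)) - ?p (?G w) = 0"
      by (rule analytic_continuation[OF _ B X _ w])
    then show "?p (f (slice_embed I w)) = ?p (?G w)"
      by simp
  qed
  then have "\<forall>I\<in>N. f (slice_embed I w) = (f (slice_embed J w) - J * c w) + I * c w"
    by (simp add: left_diff_distrib)
  then show ?thesis
    by blast
qed

lemma slice_embed_nearby:
  assumes "open \<Omega>" "slice_embed I z \<in> \<Omega>"
  obtains e where "e > 0" "\<And>J w. norm (J - I) < e \<Longrightarrow> w \<in> ball z e \<Longrightarrow> slice_embed J w \<in> \<Omega>"
proof -
  let ?S = "(\<lambda>p. slice_embed (fst p) (snd p)) -` \<Omega>"
  have "open ?S"
    unfolding slice_embed_def by (intro open_vimage assms continuous_intros)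
  moreover have "(I, z) \<in> ?S"
    using assms(2) by simp
  ultimately obtain A B where AB: "open A" "open B" "(I, z) \<in> A \<times> B" "A \<times> B \<subseteq> ?S"
    by (rule open_prod_elim)
  then have "I \<in> A" "z \<in> B"
    by simp_all
  obtain d where d: "d > 0" "ball I d \<subseteq> A"
    using \<open>open A\<close> \<open>I \<in> A\<close> openE by blast
  obtain e where e: "e > 0" "ball z e \<subseteq> B"
    using \<open>open B\<close> \<open>z \<in> B\<close> openE by blast
  show thesis
  proof (rule that[of "min d e"])
    show "slice_embed J w \<in> \<Omega>" if "norm (J - I) < min d e" "w \<in> ball z (min d e)" for J w
    proof -
      have "J \<in> A" "w \<in> B"
        using that d e by (auto simp: dist_norm norm_minus_commute subset_iff)
      then show ?thesis
        using AB(4) by auto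
    qed
  qed (use d e in auto)
qed

text \<open>
  The formula holds near the reals, where all slices meet, and continues from there
  through the connected slice of \<open>I\<close>, at each step for the imaginary units in some neighbourhood
  of \<open>I\<close>.
\<close>

lemma local_slice_formula:
  assumes \<Omega>: "open \<Omega>" "connected (slice_embed I -` \<Omega>)" "\<Omega> \<inter> \<real> \<noteq> {}"
    and f: "slice_regular \<Omega> f" and I: "I \<in> imag_units" and z: "slice_embed I z \<in> \<Omega>"
  obtains e b c where "e > 0"
    "\<And>J. J \<in> imag_units \<Longrightarrow> norm (J - I) < e \<Longrightarrow>
       slice_embed J z \<in> \<Omega> \<and> f (slice_embed J z) = b + J * c"
proof -
  let ?D = "slice_embed I -` \<Omega>"
  define N where "N e = {J \<in> imag_units. norm (J - I) < e}" for e
  \<comment> \<open>\<open>P z\<close> says that the formula holds at the points near \<open>z\<close> for the units near \<open>I\<close>.\<close>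
  define P where
    "P z \<longleftrightarrow> (\<exists>e>0. \<forall>w\<in>ball z e. \<exists>b c. \<forall>J\<in>N e. f (slice_embed J w) = b + J * c)" for z
  have N: "N e \<subseteq> imag_units" for e
    by (auto simp: N_def)
  have *: "\<exists>e>0. \<forall>J\<in>N e. \<forall>w\<in>ball z e. slice_embed J w \<in> \<Omega>" if "z \<in> ?D" for z
    using slice_embed_nearby[OF \<Omega>(1)] that unfolding N_def vimage_eq
    by (metis (mono_tags, lifting) mem_Collect_eq)
  obtain r where r: "of_real r \<in> \<Omega>"
    using \<Omega>(3) by (auto simp: Reals_def)
  have "P (of_real r)"
  proof -
    have "of_real r \<in> ?D"
      using r by simp
    then obtain e where e: "e > 0"
      "\<And>J w. J \<in> N e \<Longrightarrow> w \<in> ball (of_real r) e \<Longrightarrow> slice_embed J w \<in> \<Omega>"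
      using * by meson
    let ?B = "ball (of_real r :: complex) e"
    have "\<exists>b c. \<forall>J\<in>N e. f (slice_embed J w) = b + J * c" if "w \<in> ?B" for w
    proof (rule slice_formula_extends[OF f \<Omega>(1), where B = ?B and X = "?B \<inter> \<real>" and \<xi> = "of_real r"])
      show "slice_embed J w \<in> \<Omega>" if "J \<in> N e" "w \<in> ?B" for J w
        using e(2) that by blast
      show "?B \<inter> \<real> \<subseteq> ?B" "of_real r \<in> ?B"
        using e by auto
      show "of_real r islimpt ?B \<inter> \<real>"
        unfolding islimpt_approachable
      proof safe
        fix d :: real
        assume "d > 0"
        then have "r + min d e / 2 \<noteq> r" "\<bar>min d e / 2\<bar> < d" "\<bar>min d e / 2\<bar> < e"
          using e(1) by auto
        then show "\<exists>x'\<in>?B \<inter> \<real>. x' \<noteq> of_real r \<and> dist x' (of_real r) < d"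
          by (intro bexI[of _ "of_real (r + min d e / 2)"])
            (simp_all add: dist_norm flip: of_real_diff of_real_add)
      qed
      show "\<exists>b c. \<forall>J\<in>N e. f (slice_embed J w) = b + J * c" if w: "w \<in> ?B \<inter> \<real>" for w
      proof -
        obtain s where "w = of_real s"
          using w by (auto simp: Reals_def)
        then have "\<forall>J\<in>N e. f (slice_embed J w) = f (of_real s) + J * 0"
          by simp
        then show ?thesis
          by blast
      qed
    qed (use N that in simp_all)
    with e(1) show ?thesis
      unfolding P_def by blast
  qed
  have "P z"
  proof (rule connected_induction_simple[OF \<Omega>(2), where P = P])
    show "P (of_real r)"
      by fact
    show "of_real r \<in> ?D" "z \<in> ?D"
      using r z by simp_all
    fix a
    assume a: "a \<in> ?D"
    obtain e where e: "e > 0" "\<And>J w. J \<in> N e \<Longrightarrow> w \<in> ball a e \<Longrightarrow> slice_embed J w \<in> \<Omega>"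
      using *[OF a] by meson
    have "I \<in> N e"
      using I e(1) by (simp add: N_def)
    then have sub: "ball a e \<subseteq> ?D"
      using e(2) by blast
    \<comment> \<open>If \<open>P\<close> holds at one point of this ball, then it holds at all of them.\<close>
    show "\<exists>T. openin (top_of_set ?D) T \<and> a \<in> T \<and> (\<forall>x\<in>T. \<forall>y\<in>T. P x \<longrightarrow> P y)"
    proof (intro exI conjI ballI impI)
      show "openin (top_of_set ?D) (ball a e)"
        using sub by (auto intro: open_subset)
      show "a \<in> ball a e"
        using e by simp
      fix x y
      assume x: "x \<in> ball a e" and y: "y \<in> ball a e" and "P x"
      then obtain d where d: "d > 0"
        "\<And>w. w \<in> ball x d \<Longrightarrow> \<exists>b c. \<forall>J\<in>N d. f (slice_embed J w) = b + J * c"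
        unfolding P_def by meson
      let ?m = "min d e"
      have Nm: "N ?m \<subseteq> N d" "N ?m \<subseteq> N e"
        by (auto simp: N_def)
      have ext: "\<exists>b c. \<forall>J\<in>N ?m. f (slice_embed J w) = b + J * c" if "w \<in> ball a e" for w
      proof (rule slice_formula_extends[OF f \<Omega>(1), where B = "ball a e"
            and X = "ball a e \<inter> ball x d" and \<xi> = x])
        show "slice_embed J w \<in> \<Omega>" if "J \<in> N ?m" "w \<in> ball a e" for J w
          using e(2) that Nm by blast
        show "x islimpt ball a e \<inter> ball x d"
          using x d(1) by (intro interior_limit_point) (simp add: interior_open open_Int)
        show "\<exists>b c. \<forall>J\<in>N ?m. f (slice_embed J w) = b + J * c" if "w \<in> ball a e \<inter> ball x d" for w
          using d(2)[of w] that Nm(1) by blast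
      qed (use N x that in simp_all)
      obtain d' where d': "d' > 0" "ball y d' \<subseteq> ball a e"
        using y openE[OF open_ball] by blast
      show "P y"
        unfolding P_def
      proof (rule exI[of _ "min d' ?m"], intro conjI ballI)
        show "min d' ?m > 0"
          using d d' e by simp
        fix w
        assume "w \<in> ball y (min d' ?m)"
        then have "w \<in> ball a e"
          using d' by auto
        moreover have "N (min d' ?m) \<subseteq> N ?m"
          by (auto simp: N_def)
        ultimately show "\<exists>b c. \<forall>J\<in>N (min d' ?m). f (slice_embed J w) = b + J * c"
          using ext by blast
      qed
    qed
  qed
  then obtain d b c where d: "d > 0" "\<And>J. J \<in> N d \<Longrightarrow> f (slice_embed J z) = b + J * c"
    unfolding P_def by (metis centre_in_ball)
  obtain e where e: "e > 0" "\<And>J. J \<in> N e \<Longrightarrow> slice_embed J z \<in> \<Omega>"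
    using *[of z] z by (auto dest: centre_in_ball[THEN iffD2])
  show thesis
    by (rule that[of "min d e" b c]) (use d e in \<open>auto simp: N_def\<close>)
qed

section \<open>Spherical coefficients\<close>

lemma qsphere_eq_image: "qsphere x y = (\<lambda>J. slice_embed J (Complex x y)) ` imag_units"
  by (auto simp: qsphere_def slice_embed_def)

lemma slice_embed_in_qsphere_iff:
  assumes I: "I \<in> imag_units"
  shows "slice_embed I z \<in> qsphere x y \<longleftrightarrow> Re z = x \<and> \<bar>Im z\<bar> = \<bar>y\<bar>"
proof
  assume "slice_embed I z \<in> qsphere x y"
  then obtain J where J: "J \<in> imag_units" "slice_embed I z = slice_embed J (Complex x y)"
    by (auto simp: qsphere_eq_image)
  have "Re z = x"
    using arg_cong[OF J(2), of qRe] I J(1) by (simp add: qRe_slice_embed)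
  moreover have "\<bar>Im z\<bar> = \<bar>y\<bar>"
    using arg_cong[OF J(2), of "\<lambda>q. norm (qIm q)"] I J(1)
    by (simp add: qIm_slice_embed norm_mult imag_unitsD(2))
  ultimately show "Re z = x \<and> \<bar>Im z\<bar> = \<bar>y\<bar>"
    by simp
next
  assume *: "Re z = x \<and> \<bar>Im z\<bar> = \<bar>y\<bar>"
  then consider "Im z = y" | "Im z = - y"
    by linarith
  then show "slice_embed I z \<in> qsphere x y"
  proof cases
    case 1
    with * have "slice_embed I z = slice_embed I (Complex x y)"
      by (simp add: slice_embed_def)
    with I show ?thesis
      unfolding qsphere_eq_image by blast
  next
    case 2
    with * have "slice_embed I z = slice_embed (- I) (Complex x y)"
      by (simp add: slice_embed_def)
    with imag_units_uminus[OF I] show ?thesis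
      unfolding qsphere_eq_image by blast
  qed
qed

lemma slice_embed_in_Reals_iff:
  assumes I: "I \<in> imag_units"
  shows "slice_embed I z \<in> \<real> \<longleftrightarrow> Im z = 0"
proof
  assume "slice_embed I z \<in> \<real>"
  then obtain r where "slice_embed I z = slice_embed I (of_real r)"
    by (auto simp: Reals_def)
  then have "z = of_real r"
    by (rule injD[OF inj_slice_embed[OF I]])
  then show "Im z = 0"
    by simp
next
  assume "Im z = 0"
  then have "slice_embed I z = of_real (Re z)"
    by (simp add: slice_embed_def)
  then show "slice_embed I z \<in> \<real>"
    by simp
qed

lemma dist_slice_embed_sphere:
  assumes "y > 0"
  shows "dist (slice_embed J (Complex x y)) (slice_embed I (Complex x y)) = y * norm (J - I)"
proof -
  have "slice_embed J (Complex x y) - slice_embed I (Complex x y) = y *\<^sub>R (J - I)"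
    by (simp add: slice_embed_def of_real_mult_quat scaleR_diff_right)
  with assms show ?thesis
    by (simp add: dist_norm)
qed

text \<open>The neighbourhoods in the sphere can be taken to be balls of imaginary units.\<close>

lemma has_spherical_coeffs_iff:
  assumes I: "I \<in> imag_units" and y: "y > 0"
  shows "has_spherical_coeffs \<Omega> f (slice_embed I (Complex x y)) b c \<longleftrightarrow>
    (\<exists>e>0. \<forall>J\<in>imag_units. norm (J - I) < e \<longrightarrow>
       slice_embed J (Complex x y) \<in> \<Omega> \<and> f (slice_embed J (Complex x y)) = b + J * c)"
    (is "?L \<longleftrightarrow> ?R")
proof -
  have co: "qRe (slice_embed I (Complex x y)) = x" "norm (qIm (slice_embed I (Complex x y))) = y"
    using I y by (simp_all add: qRe_slice_embed qIm_slice_embed norm_mult imag_unitsD)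
  have sl: "of_real x + of_real y * J = slice_embed J (Complex x y)" for J
    by (simp add: slice_embed_def)
  have L: "?L \<longleftrightarrow> (\<exists>U. openin (top_of_set (qsphere x y)) U \<and> slice_embed I (Complex x y) \<in> U \<and>
      U \<subseteq> \<Omega> \<and> (\<forall>J\<in>imag_units. slice_embed J (Complex x y) \<in> U \<longrightarrow>
        f (slice_embed J (Complex x y)) = b + J * c))"
    unfolding has_spherical_coeffs_def Let_def co sl by simp
  show ?thesis
  proof
    assume ?L
    then obtain U where U: "openin (top_of_set (qsphere x y)) U" "slice_embed I (Complex x y) \<in> U"
      "U \<subseteq> \<Omega>" "\<And>J. J \<in> imag_units \<Longrightarrow> slice_embed J (Complex x y) \<in> U \<Longrightarrow>
        f (slice_embed J (Complex x y)) = b + J * c"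
      unfolding L by blast
    obtain T where T: "open T" "U = qsphere x y \<inter> T"
      using U(1) by (auto simp: openin_open)
    have "slice_embed I (Complex x y) \<in> T"
      using U(2) T(2) by simp
    then obtain e where e: "e > 0"
      "\<And>J w. norm (J - I) < e \<Longrightarrow> w \<in> ball (Complex x y) e \<Longrightarrow> slice_embed J w \<in> T"
      using slice_embed_nearby[OF T(1)] by metis
    have in_U: "slice_embed J (Complex x y) \<in> U" if "J \<in> imag_units" "norm (J - I) < e" for J
      unfolding T(2) using e that by (simp add: slice_embed_in_qsphere_iff)
    show ?R
      using e(1) in_U U(3,4) by (intro exI[of _ e]) auto
  next
    assume ?R
    then obtain e where e: "e > 0" "\<And>J. J \<in> imag_units \<Longrightarrow> norm (J - I) < e \<Longrightarrow>
      slice_embed J (Complex x y) \<in> \<Omega> \<and> f (slice_embed J (Complex x y)) = b + J * c"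
      by blast
    define U where "U = qsphere x y \<inter> ball (slice_embed I (Complex x y)) (y * e)"
    have U: "slice_embed J (Complex x y) \<in> U \<longleftrightarrow> norm (J - I) < e" if "J \<in> imag_units" for J
      using that y
      by (simp add: U_def slice_embed_in_qsphere_iff dist_commute[of "slice_embed I (Complex x y)"]
          dist_slice_embed_sphere)
    have "U \<subseteq> \<Omega>"
    proof
      fix q
      assume q: "q \<in> U"
      then obtain J where "J \<in> imag_units" "q = slice_embed J (Complex x y)"
        unfolding U_def qsphere_eq_image by blast
      with q show "q \<in> \<Omega>"
        using U e(2) by blast
    qed
    moreover have "openin (top_of_set (qsphere x y)) U"
      unfolding U_def by (rule openin_open_Int) simp
    moreover have "slice_embed I (Complex x y) \<in> U"
      using U[OF I] e(1) by simp
    ultimately show ?L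
      unfolding L using U e(2) by (intro exI[of _ U]) auto
  qed
qed

text \<open>The values of \<open>b + Ic\<close> at two imaginary units determine \<open>b\<close> and \<open>c\<close>.\<close>

lemma spherical_coeffs_eq:
  assumes I: "I \<in> imag_units" and y: "y > 0"
    and coeffs: "has_spherical_coeffs \<Omega> f (slice_embed I (Complex x y)) b c"
  shows "spherical_coeffs \<Omega> f (slice_embed I (Complex x y)) = (b, c)"
proof -
  let ?p = "slice_embed I (Complex x y)"
  have "b' = b \<and> c' = c" if coeffs': "has_spherical_coeffs \<Omega> f ?p b' c'" for b' c'
  proof -
    let ?f = "\<lambda>J. f (slice_embed J (Complex x y))"
    obtain d where d: "d > 0" "\<And>J. J \<in> imag_units \<Longrightarrow> norm (J - I) < d \<Longrightarrow> ?f J = b + J * c"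
      using coeffs unfolding has_spherical_coeffs_iff[OF I y] by blast
    obtain e where e: "e > 0" "\<And>J. J \<in> imag_units \<Longrightarrow> norm (J - I) < e \<Longrightarrow> ?f J = b' + J * c'"
      using coeffs' unfolding has_spherical_coeffs_iff[OF I y] by blast
    obtain J where J: "J \<in> imag_units" "J \<noteq> I" "norm (J - I) < min d e"
      using imag_units_nearby[OF I, of "min d e"] d(1) e(1) by auto
    have eqs: "b + J * c = b' + J * c'" "b + I * c = b' + I * c'"
      using d(2)[of J] e(2)[of J] d(2)[of I] e(2)[of I] I J d(1) e(1) by simp_all
    then have "(b + J * c) - (b + I * c) = (b' + J * c') - (b' + I * c')"
      by simp
    then have "(J - I) * (c - c') = 0"
      by (simp add: algebra_simps)
    then have "c = c'"
      using J(2) by simp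
    with eqs show ?thesis
      by simp
  qed
  then show ?thesis
    unfolding spherical_coeffs_def by (intro the_equality) (simp_all add: coeffs split: prod.splits)
qed

lemma spherical_coeffs_exist:
  assumes \<Omega>: "slice_domain \<Omega>" and f: "slice_regular \<Omega> f"
    and I: "I \<in> imag_units" and y: "y > 0" and p: "slice_embed I (Complex x y) \<in> \<Omega>"
  obtains b c where "has_spherical_coeffs \<Omega> f (slice_embed I (Complex x y)) b c"
proof -
  have "open \<Omega>" "connected (slice_embed I -` \<Omega>)" "\<Omega> \<inter> \<real> \<noteq> {}"
    using \<Omega> I by (auto simp: slice_domain_def connected_vimage_slice_embed_iff)
  from local_slice_formula[OF this f I p] obtain e b c where "e > 0"
    "\<And>J. J \<in> imag_units \<Longrightarrow> norm (J - I) < e \<Longrightarrow>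
       slice_embed J (Complex x y) \<in> \<Omega> \<and> f (slice_embed J (Complex x y)) = b + J * c"
    by blast
  then have "has_spherical_coeffs \<Omega> f (slice_embed I (Complex x y)) b c"
    unfolding has_spherical_coeffs_iff[OF I y] by blast
  then show thesis
    by (rule that)
qed

text \<open>The spherical coefficients are locally constant on the sphere.\<close>

lemma has_spherical_coeffs_nearby:
  assumes I: "I \<in> imag_units" and y: "y > 0"
    and coeffs: "has_spherical_coeffs \<Omega> f (slice_embed I (Complex x y)) b c"
  obtains e where "e > 0" "\<And>J. J \<in> imag_units \<Longrightarrow> norm (J - I) < e \<Longrightarrow>
    f (slice_embed J (Complex x y)) = b + J * c \<and>
    has_spherical_coeffs \<Omega> f (slice_embed J (Complex x y)) b c"
proof -
  obtain e where e: "e > 0" "\<And>J. J \<in> imag_units \<Longrightarrow> norm (J - I) < e \<Longrightarrow>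
      slice_embed J (Complex x y) \<in> \<Omega> \<and> f (slice_embed J (Complex x y)) = b + J * c"
    using coeffs unfolding has_spherical_coeffs_iff[OF I y] by blast
  have "has_spherical_coeffs \<Omega> f (slice_embed J (Complex x y)) b c"
    if J: "J \<in> imag_units" "norm (J - I) < e" for J
    unfolding has_spherical_coeffs_iff[OF J(1) y]
  proof (intro exI[of _ "e - norm (J - I)"] conjI ballI impI)
    fix K
    assume K: "K \<in> imag_units" "norm (K - J) < e - norm (J - I)"
    have "norm (K - I) \<le> norm (K - J) + norm (J - I)"
      using norm_triangle_ineq[of "K - J" "J - I"] by simp
    with K have "norm (K - I) < e"
      by simp
    with K(1) show "slice_embed K (Complex x y) \<in> \<Omega>" "f (slice_embed K (Complex x y)) = b + K * c"
      using e(2) by blast+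
  qed (use J in simp)
  with e show thesis
    using that by blast
qed

lemma has_spherical_coeffs_at:
  assumes I: "I \<in> imag_units" and y: "y > 0"
    and coeffs: "has_spherical_coeffs \<Omega> f (slice_embed I (Complex x y)) b c"
  shows "slice_embed I (Complex x y) \<in> \<Omega>" "f (slice_embed I (Complex x y)) = b + I * c"
  using coeffs I unfolding has_spherical_coeffs_iff[OF I y] by auto

lemma spherical_value_deriv_slice_embed:
  assumes I: "I \<in> imag_units" and y: "y > 0"
    and coeffs: "has_spherical_coeffs \<Omega> f (slice_embed I (Complex x y)) b c"
  shows "spherical_value \<Omega> f (slice_embed I (Complex x y)) = b"
    and "spherical_deriv \<Omega> f (slice_embed I (Complex x y)) = c /\<^sub>R y"
  using y spherical_coeffs_eq[OF assms]
  by (simp_all add: spherical_value_def spherical_deriv_def slice_embed_in_Reals_iff[OF I]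
      qIm_slice_embed[OF I] norm_mult imag_unitsD(2)[OF I])

lemma slice_embed_in_singular_part_iff:
  assumes I: "I \<in> imag_units" and y: "y > 0"
    and coeffs: "has_spherical_coeffs \<Omega> f (slice_embed I (Complex x y)) b c"
  shows "slice_embed I (Complex x y) \<in> singular_part \<Omega> f (qsphere x y) \<longleftrightarrow> b \<noteq> 0 \<or> c \<noteq> 0"
proof -
  have "slice_embed I (Complex x y) \<in> \<Omega>"
    by (rule has_spherical_coeffs_at(1)[OF assms])
  moreover have "slice_embed I (Complex x y) \<in> qsphere x y"
    by (simp add: slice_embed_in_qsphere_iff[OF I])
  ultimately show ?thesis
    using y by (simp add: singular_part_def spherical_value_deriv_slice_embed[OF assms])
qed

section \<open>The quadratic polynomial of a sphere\<close>

text \<open>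
  The polynomial \<open>(q - x)\<^sup>2 + y\<^sup>2\<close>, over the quaternions and over the complex numbers at once;
  it commutes with \<open>slice_embed I\<close>.
\<close>

definition sphere_poly :: "real \<Rightarrow> real \<Rightarrow> 'a :: real_algebra_1 \<Rightarrow> 'a" where
  "sphere_poly x y q = (q - of_real x)\<^sup>2 + (of_real y)\<^sup>2"

lemma sphere_poly_slice_embed:
  "I \<in> imag_units \<Longrightarrow> sphere_poly x y (slice_embed I z) = slice_embed I (sphere_poly x y z)"
  by (simp add: sphere_poly_def power2_eq_square slice_embed_add slice_embed_diff slice_embed_mult)

lemma sphere_poly_complex_factor:
  "sphere_poly x y z = (z - Complex x y) * (z - Complex x (- y))"
  by (simp add: sphere_poly_def complex_eq_iff power2_eq_square algebra_simps)

lemma sphere_poly_eq_0_iff: "sphere_poly x y q = 0 \<longleftrightarrow> q \<in> qsphere x y" for q :: quat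
proof -
  obtain I z where q: "I \<in> imag_units" "q = slice_embed I z"
    by (rule quat_in_slice)
  have "sphere_poly x y q = 0 \<longleftrightarrow> sphere_poly x y z = 0"
    using inj_slice_embed[OF q(1)] unfolding q(2) sphere_poly_slice_embed[OF q(1)]
    by (metis injD slice_embed_0)
  also have "\<dots> \<longleftrightarrow> Re z = x \<and> \<bar>Im z\<bar> = \<bar>y\<bar>"
    unfolding sphere_poly_complex_factor mult_eq_0_iff by (auto simp: complex_eq_iff abs_eq_iff)
  finally show ?thesis
    by (simp add: q slice_embed_in_qsphere_iff)
qed

lemma continuous_on_sphere_poly: "continuous_on S (sphere_poly x y :: quat \<Rightarrow> quat)"
  unfolding sphere_poly_def [abs_def] by (intro continuous_intros)

lemma closed_qsphere: "closed (qsphere x y)"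
proof -
  have "qsphere x y = sphere_poly x y -` {0}"
    by (auto simp: sphere_poly_eq_0_iff)
  then show ?thesis
    using continuous_closed_vimage[of "{0}" "sphere_poly x y :: quat \<Rightarrow> quat"]
      continuous_on_sphere_poly[of UNIV x y]
    by (simp add: continuous_on_eq_continuous_at)
qed

section \<open>Removing the singular part of a sphere\<close>

text \<open>As the coefficients are locally constant, the singular part is closed in \<open>\<Omega>\<close>.\<close>

lemma open_diff_singular_part:
  assumes \<Omega>: "slice_domain \<Omega>" and f: "slice_regular \<Omega> f" and y: "y > 0"
  shows "open (\<Omega> - singular_part \<Omega> f (qsphere x y))"
  unfolding open_subopen[of "\<Omega> - singular_part \<Omega> f (qsphere x y)"]
proof
  fix p
  assume p: "p \<in> \<Omega> - singular_part \<Omega> f (qsphere x y)"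
  have o\<Omega>: "open \<Omega>"
    using \<Omega> by (simp add: slice_domain_def)
  have sub: "singular_part \<Omega> f (qsphere x y) \<subseteq> qsphere x y"
    by (auto simp: singular_part_def)
  show "\<exists>T. open T \<and> p \<in> T \<and> T \<subseteq> \<Omega> - singular_part \<Omega> f (qsphere x y)"
  proof (cases "p \<in> qsphere x y")
    case False
    then show ?thesis
      using open_Diff[OF o\<Omega> closed_qsphere[of x y]] p sub
      by (intro exI[of _ "\<Omega> - qsphere x y"]) blast
  next
    case True
    then obtain I where I: "I \<in> imag_units" "p = slice_embed I (Complex x y)"
      by (auto simp: qsphere_eq_image)
    have "slice_embed I (Complex x y) \<in> \<Omega>"
      using p I(2) by simp
    then obtain b c where bc: "has_spherical_coeffs \<Omega> f (slice_embed I (Complex x y)) b c"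
      by (rule spherical_coeffs_exist[OF \<Omega> f I(1) y])
    have "b = 0" "c = 0"
      using slice_embed_in_singular_part_iff[OF I(1) y bc] p unfolding I(2) by simp_all
    with bc have "has_spherical_coeffs \<Omega> f (slice_embed I (Complex x y)) 0 0"
      by simp
    then obtain e where e: "e > 0" "\<And>J. J \<in> imag_units \<Longrightarrow> norm (J - I) < e \<Longrightarrow>
        has_spherical_coeffs \<Omega> f (slice_embed J (Complex x y)) 0 0"
      by (rule has_spherical_coeffs_nearby[OF I(1) y]) blast
    have "q \<notin> singular_part \<Omega> f (qsphere x y)" if q: "q \<in> ball p (y * e)" for q
    proof
      assume s: "q \<in> singular_part \<Omega> f (qsphere x y)"
      with sub obtain J where J: "J \<in> imag_units" "q = slice_embed J (Complex x y)"
        by (auto simp: qsphere_eq_image)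
      have "dist q p = y * norm (J - I)"
        using y by (simp add: I J dist_slice_embed_sphere)
      with q y have "norm (J - I) < e"
        by (simp add: dist_commute)
      with e J(1) have "has_spherical_coeffs \<Omega> f (slice_embed J (Complex x y)) 0 0"
        by blast
      then show False
        using slice_embed_in_singular_part_iff[OF J(1) y] s unfolding J(2) by simp
    qed
    then show ?thesis
      using e(1) p open_Int[OF o\<Omega> open_ball[of p "y * e"]] y
      by (intro exI[of _ "\<Omega> \<inter> ball p (y * e)"]) (auto simp del: mem_ball simp: centre_in_ball)
  qed
qed

text \<open>On each slice at most two points are removed, and all slices share the real points.\<close>

lemma slice_domain_diff_subset_qsphere:
  assumes \<Omega>: "slice_domain \<Omega>" and "open (\<Omega> - C)" and C: "C \<subseteq> qsphere x y" and y: "y > 0"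
  shows "slice_domain (\<Omega> - C)"
proof -
  have conn: "connected ((\<Omega> - C) \<inter> slice_plane I)" if I: "I \<in> imag_units" for I
  proof -
    have "slice_embed I -` C \<subseteq> {Complex x y, Complex x (- y)}"
    proof
      fix z
      assume "z \<in> slice_embed I -` C"
      then have "slice_embed I z \<in> qsphere x y"
        using C by blast
      then show "z \<in> {Complex x y, Complex x (- y)}"
        by (auto simp: slice_embed_in_qsphere_iff[OF I] complex_eq_iff abs_eq_iff)
    qed
    then have "countable (slice_embed I -` C)"
      by (rule countable_subset) simp
    moreover have "open (slice_embed I -` \<Omega>)"
      using \<Omega> by (intro open_vimage_slice_embed) (simp add: slice_domain_def)
    moreover have "connected (slice_embed I -` \<Omega>)"
      using \<Omega> I by (simp add: slice_domain_def connected_vimage_slice_embed_iff)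
    ultimately have "connected (slice_embed I -` \<Omega> - slice_embed I -` C)"
      by (intro connected_open_diff_countable) auto
    then show ?thesis
      by (simp add: connected_vimage_slice_embed_iff[OF I, symmetric] vimage_Diff)
  qed
  obtain r where "of_real r \<in> \<Omega>"
    using \<Omega> by (auto simp: slice_domain_def Reals_def)
  moreover have "of_real r \<notin> qsphere x y"
    using slice_embed_in_qsphere_iff[OF imag_units_Quat(1), of "of_real r" x y] y by simp
  ultimately have r: "of_real r \<in> \<Omega> - C"
    using C by blast
  have rI: "of_real r \<in> (\<Omega> - C) \<inter> slice_plane I" for I
    using r by (metis IntI slice_plane_eq_range rangeI slice_embed_of_real)
  have "\<Omega> - C \<subseteq> (\<Union>I\<in>imag_units. (\<Omega> - C) \<inter> slice_plane I)"
  proof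
    fix q
    assume "q \<in> \<Omega> - C"
    moreover obtain I z where "I \<in> imag_units" "q = slice_embed I z"
      by (rule quat_in_slice)
    ultimately show "q \<in> (\<Union>I\<in>imag_units. (\<Omega> - C) \<inter> slice_plane I)"
      unfolding slice_plane_eq_range by blast
  qed
  then have "\<Omega> - C = (\<Union>I\<in>imag_units. (\<Omega> - C) \<inter> slice_plane I)"
    by blast
  moreover have "connected (\<Union>I\<in>imag_units. (\<Omega> - C) \<inter> slice_plane I)"
  proof (rule connected_Union)
    show "connected S" if "S \<in> (\<lambda>I. (\<Omega> - C) \<inter> slice_plane I) ` imag_units" for S
      using that conn by auto
    have "of_real r \<in> (\<Inter>I\<in>imag_units. (\<Omega> - C) \<inter> slice_plane I)"
      using rI by simp
    then show "(\<Inter>I\<in>imag_units. (\<Omega> - C) \<inter> slice_plane I) \<noteq> {}"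
      by (metis empty_iff)
  qed
  ultimately have "connected (\<Omega> - C)"
    by simp
  moreover have "openin (top_of_set (slice_plane I)) ((\<Omega> - C) \<inter> slice_plane I)" for I
    using openin_open_Int[OF assms(2), of "slice_plane I"] by (simp add: Int_commute)
  moreover have "(\<Omega> - C) \<inter> \<real> \<noteq> {}"
  proof -
    have "of_real r \<in> (\<Omega> - C) \<inter> \<real>"
      using r by simp
    then show ?thesis
      by (metis empty_iff)
  qed
  moreover have "(\<Omega> - C) \<inter> slice_plane I \<noteq> {}" for I
    using rI[of I] by (metis empty_iff)
  ultimately show ?thesis
    unfolding slice_domain_def by (simp add: assms(2) conn)
qed

section \<open>Division by the quadratic polynomial\<close>

text \<open>
  At a zero \<open>q\<close> of \<open>P = sphere_poly x y\<close> the quotient \<open>f / P\<close> takes the value \<open>f'(q) / P'(q)\<close>,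
  where the derivative of \<open>f\<close> along the slice of \<open>q\<close> is the partial derivative in the real direction.
\<close>

definition sphere_quotient :: "real \<Rightarrow> real \<Rightarrow> (quat \<Rightarrow> quat) \<Rightarrow> quat \<Rightarrow> quat" where
  "sphere_quotient x y f q =
     (if sphere_poly x y q = 0
      then inverse (2 * (q - of_real x)) * vector_derivative (\<lambda>t. f (q + of_real t)) (at 0)
      else inverse (sphere_poly x y q) * f q)"

lemma sphere_poly_times_quotient:
  assumes "sphere_poly x y q = 0 \<Longrightarrow> f q = 0"
  shows "sphere_poly x y q * sphere_quotient x y f q = f q"
  using assms by (auto simp: sphere_quotient_def mult.assoc[symmetric])

lemma slice_embed_inverse:
  assumes I: "I \<in> imag_units"
  shows "inverse (slice_embed I z) = slice_embed I (inverse z)"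
proof (cases "z = 0")
  case False
  then have "slice_embed I z * slice_embed I (inverse z) = 1"
    by (simp flip: slice_embed_mult[OF I])
  then show ?thesis
    by (rule inverse_unique)
qed simp

lemma slice_functional_inverse_mult:
  assumes I: "I \<in> imag_units"
  shows "slice_functional I u (inverse (slice_embed I w) * q) = slice_functional I u q / w"
  by (simp add: slice_embed_inverse[OF I] slice_functional_mult[OF I] divide_inverse mult.commute)

lemma slice_functional_sphere_quotient:
  assumes I: "I \<in> imag_units"
    and g: "left_holomorphic I D (\<lambda>z. f (slice_embed I z))" and z: "z \<in> D"
  defines "F \<equiv> \<lambda>u z. slice_functional I u (f (slice_embed I z))"
  shows "slice_functional I u (sphere_quotient x y f (slice_embed I z)) =
    (if sphere_poly x y z = 0 then deriv (F u) z / (2 * (z - of_real x))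
     else F u z / sphere_poly x y z)"
proof -
  have P0: "sphere_poly x y (slice_embed I z) = 0 \<longleftrightarrow> sphere_poly x y z = 0"
    unfolding sphere_poly_slice_embed[OF I] using inj_slice_embed[OF I] by (metis injD slice_embed_0)
  show ?thesis
  proof (cases "sphere_poly x y z = 0")
    case False
    with P0 show ?thesis
      by (simp add: sphere_quotient_def F_def sphere_poly_slice_embed[OF I]
          slice_functional_inverse_mult[OF I])
  next
    case True
    obtain d where d: "((\<lambda>z. f (slice_embed I z)) has_derivative (\<lambda>w. slice_embed I w * d)) (at z)"
      using g z unfolding left_holomorphic_def by blast
    have "((\<lambda>t. z + of_real t) has_derivative (\<lambda>t. of_real t)) (at 0)"
      by (auto intro!: derivative_eq_intros)
    moreover have "((\<lambda>z. f (slice_embed I z)) has_derivative (\<lambda>w. slice_embed I w * d))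
        (at (z + of_real 0))"
      using d by simp
    ultimately have "((\<lambda>z. f (slice_embed I z)) \<circ> (\<lambda>t. z + of_real t) has_derivative
        (\<lambda>w. slice_embed I w * d) \<circ> (\<lambda>t. of_real t)) (at 0)"
      by (rule diff_chain_at)
    then have "((\<lambda>t. f (slice_embed I z + of_real t)) has_vector_derivative d) (at 0)"
      by (simp add: o_def slice_embed_add has_vector_derivative_def of_real_mult_quat)
    then have "vector_derivative (\<lambda>t. f (slice_embed I z + of_real t)) (at 0) = d"
      by (rule vector_derivative_at)
    moreover have "2 * (slice_embed I z - of_real x) = slice_embed I (2 * (z - of_real x))"
      using slice_embed_of_real[of I 2] by (simp add: slice_embed_mult[OF I] slice_embed_diff)
    moreover have "deriv (F u) z = slice_functional I u d"
      unfolding F_def by (rule DERIV_imp_deriv[OF has_derivative_slice_functional[OF I d]])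
    ultimately show ?thesis
      using True P0 by (simp add: sphere_quotient_def slice_functional_inverse_mult[OF I])
  qed
qed

text \<open>A zero of \<open>sphere_poly x y\<close> on the slice is simple, so a zero of \<open>f\<close> cancels it.\<close>

lemma left_holomorphic_sphere_quotient:
  assumes I: "I \<in> imag_units" and D: "open D" and y: "y > 0"
    and g: "left_holomorphic I D (\<lambda>z. f (slice_embed I z))"
    and zero: "\<And>z. z \<in> D \<Longrightarrow> sphere_poly x y z = 0 \<Longrightarrow> f (slice_embed I z) = 0"
  shows "left_holomorphic I D (\<lambda>z. sphere_quotient x y f (slice_embed I z))"
  unfolding left_holomorphic_iff[OF I D]
proof
  fix u
  define F where "F = (\<lambda>z. slice_functional I u (f (slice_embed I z)))"
  define H where "H = (\<lambda>z. slice_functional I u (sphere_quotient x y f (slice_embed I z)))"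
  have F: "F holomorphic_on D"
    using g unfolding F_def left_holomorphic_iff[OF I D] by blast
  have H: "H z = (if sphere_poly x y z = 0 then deriv F z / (2 * (z - of_real x))
      else F z / sphere_poly x y z)" if "z \<in> D" for z
    unfolding H_def F_def by (rule slice_functional_sphere_quotient[OF I g that])
  define \<alpha> where "\<alpha> = Complex x y"
  have P: "sphere_poly x y z = (z - \<alpha>) * (z - cnj \<alpha>)" for z
    by (simp add: sphere_poly_complex_factor \<alpha>_def complex_cnj)
  have "H field_differentiable at a" if a: "a \<in> D" for a
  proof -
    obtain E where "open E" "a \<in> E" "H holomorphic_on E"
    proof (cases "sphere_poly x y a = 0")
      case False
      have "(\<lambda>z. F z / sphere_poly x y z) holomorphic_on D - {\<alpha>, cnj \<alpha>}"
        unfolding P by (intro holomorphic_intros holomorphic_on_subset[OF F]) auto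
      then have "H holomorphic_on D - {\<alpha>, cnj \<alpha>}"
        by (rule holomorphic_transform) (auto simp: H P)
      then show thesis
        using that[of "D - {\<alpha>, cnj \<alpha>}"] a False D by (auto simp: P open_Diff)
    next
      case True
      then have "a = \<alpha> \<or> a = cnj \<alpha>"
        by (auto simp: P)
      then have Pa: "sphere_poly x y z = (z - a) * (z - cnj a)" for z
        by (auto simp: P)
      have ca: "a \<noteq> cnj a" and dbl: "2 * (a - of_real x) = a - cnj a"
        using \<open>a = \<alpha> \<or> a = cnj \<alpha>\<close> y by (auto simp: \<alpha>_def complex_eq_iff)
      have "F a = 0"
        using zero[OF a True] by (simp add: F_def)
      have "(\<lambda>z. if z = a then deriv F a else (F z - F a) / (z - a)) holomorphic_on D"
        using a D by (intro pole_lemma F) (simp add: interior_open)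
      then have "(\<lambda>z. if z = a then deriv F a else (F z - F a) / (z - a)) holomorphic_on D - {cnj a}"
        by (rule holomorphic_on_subset) blast
      then have "(\<lambda>z. (if z = a then deriv F a else (F z - F a) / (z - a)) / (z - cnj a))
          holomorphic_on D - {cnj a}"
        by (rule holomorphic_on_divide)
          (simp_all add: holomorphic_on_diff holomorphic_on_ident holomorphic_on_const)
      moreover have "H a = deriv F a / (a - cnj a)"
        using H[OF a] True unfolding dbl by simp
      then have "(if z = a then deriv F a else (F z - F a) / (z - a)) / (z - cnj a) = H z"
        if "z \<in> D - {cnj a}" for z
        using that H[of z] \<open>F a = 0\<close> by (cases "z = a") (simp_all add: Pa)
      ultimately have "H holomorphic_on D - {cnj a}"
        by (metis (no_types, lifting) holomorphic_transform)
      then show thesis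
        using that[of "D - {cnj a}"] a ca D by (auto simp: open_Diff)
    qed
    then show ?thesis
      by (metis holomorphic_on_imp_differentiable_at)
  qed
  then show "(\<lambda>z. slice_functional I u (sphere_quotient x y f (slice_embed I z))) holomorphic_on D"
    unfolding H_def[symmetric]
    by (auto simp: holomorphic_on_def field_differentiable_at_within)
qed

section \<open>The regular product with the quadratic polynomial\<close>

text \<open>The spherical coefficients of \<open>sphere_poly x0 y0\<close> are real, so they commute with everything.\<close>

lemma regular_product_sphere_poly:
  assumes \<Omega>: "slice_domain \<Omega>" and h: "slice_regular \<Omega> h" and q: "q \<in> \<Omega>"
  shows "regular_product \<Omega> (sphere_poly x0 y0) h q = sphere_poly x0 y0 q * h q"
proof (cases "q \<in> \<real>")
  case True
  then show ?thesis
    by (simp add: regular_product_def)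
next
  case False
  obtain I x y where I: "I \<in> imag_units" and qI: "q = slice_embed I (Complex x y)" and y: "y > 0"
    by (rule quat_nonreal_in_slice[OF False])
  define w where "w = sphere_poly x0 y0 (Complex x y)"
  have P: "sphere_poly x0 y0 (slice_embed J (Complex x y)) = of_real (Re w) + J * of_real (Im w)"
    if "J \<in> imag_units" for J
    unfolding sphere_poly_slice_embed[OF that] w_def[symmetric]
    by (simp add: slice_embed_def of_real_commute_quat)
  have "open \<Omega>" and qI_in: "slice_embed I (Complex x y) \<in> \<Omega>"
    using \<Omega> q unfolding qI by (simp_all add: slice_domain_def)
  then obtain e where "e > 0"
    "\<And>J w. norm (J - I) < e \<Longrightarrow> w \<in> ball (Complex x y) e \<Longrightarrow> slice_embed J w \<in> \<Omega>"
  proof (rule slice_embed_nearby)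
    fix e :: real
    assume "e > 0" "\<And>J w. norm (J - I) < e \<Longrightarrow> w \<in> ball (Complex x y) e \<Longrightarrow> slice_embed J w \<in> \<Omega>"
    then show thesis
      by (rule that)
  qed
  then have P_coeffs: "has_spherical_coeffs \<Omega> (sphere_poly x0 y0) (slice_embed I (Complex x y))
      (of_real (Re w)) (of_real (Im w))"
    unfolding has_spherical_coeffs_iff[OF I y] by (intro exI[of _ e]) (simp add: P)
  obtain b c where h_coeffs: "has_spherical_coeffs \<Omega> h (slice_embed I (Complex x y)) b c"
    by (rule spherical_coeffs_exist[OF \<Omega> h I y qI_in])
  have hq: "h q = b + I * c"
    unfolding qI by (rule has_spherical_coeffs_at(2)[OF I y h_coeffs])
  \<comment> \<open>The spherical derivatives of \<open>h\<close> and of the polynomial are \<open>c'\<close> and \<open>v\<close>.\<close>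
  define c' v where "c' = c /\<^sub>R y" and "v = Im w / y"
  have c': "c = y *\<^sub>R c'" and v: "Im w = y * v"
    using y by (simp_all add: c'_def v_def)
  have "spherical_value \<Omega> (sphere_poly x0 y0) q = of_real (Re w)" "spherical_value \<Omega> h q = b"
    "spherical_deriv \<Omega> (sphere_poly x0 y0) q = of_real v" "spherical_deriv \<Omega> h q = c'"
    unfolding qI using y
    by (simp_all add: spherical_value_deriv_slice_embed[OF I y P_coeffs]
        spherical_value_deriv_slice_embed[OF I y h_coeffs] c' v of_real_mult_quat)
  moreover have "qIm q = y *\<^sub>R I"
    by (simp add: qI qIm_slice_embed[OF I] of_real_mult_quat)
  ultimately have "regular_product \<Omega> (sphere_poly x0 y0) h q =
      Re w *\<^sub>R b - (y * y * v) *\<^sub>R c' + (Re w * y) *\<^sub>R (I * c') + (v * y) *\<^sub>R (I * b)"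
    using False by (simp add: regular_product_def power2_eq_square of_real_mult_quat
        imag_unitsD(3,4)[OF I] distrib_left scaleR_add_right)
  also have "\<dots> = (Re w *\<^sub>R 1 + (y * v) *\<^sub>R I) * (b + y *\<^sub>R (I * c'))"
    by (simp add: distrib_left distrib_right scaleR_add_right scaleR_diff_right
        imag_unitsD(4)[OF I] ac_simps)
  also have "\<dots> = (of_real (Re w) + I * of_real (Im w)) * (b + I * c)"
    by (simp add: of_real_def c' v)
  finally show ?thesis
    using P[OF I] hq by (simp add: qI)
qed

section \<open>The singularities are not removable\<close>

text \<open>
  If \<open>b + Ic\<close> vanishes for one imaginary unit but not both coefficients are zero,
  it does not vanish for any other imaginary unit.
\<close>

lemma singular_part_nonzero_nearby:
  assumes \<Omega>: "slice_domain \<Omega>" and f: "slice_regular \<Omega> f" and y: "y > 0"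
    and V: "open V" and p: "p \<in> V" "p \<in> singular_part \<Omega> f (qsphere x y)"
  obtains I where "I \<in> imag_units" "slice_embed I (Complex x y) \<in> V"
    "slice_embed I (Complex x y) \<in> singular_part \<Omega> f (qsphere x y)"
    "f (slice_embed I (Complex x y)) \<noteq> 0"
proof -
  obtain I where I: "I \<in> imag_units" and pI: "p = slice_embed I (Complex x y)"
    using p(2) by (auto simp: singular_part_def qsphere_eq_image)
  have "slice_embed I (Complex x y) \<in> \<Omega>"
    using p(2) unfolding pI singular_part_def by simp
  then obtain b c where bc: "has_spherical_coeffs \<Omega> f (slice_embed I (Complex x y)) b c"
    by (rule spherical_coeffs_exist[OF \<Omega> f I y])
  with p(2) have nz: "b \<noteq> 0 \<or> c \<noteq> 0"
    unfolding pI by (simp add: slice_embed_in_singular_part_iff[OF I y])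
  obtain d where d: "d > 0" "\<And>J. J \<in> imag_units \<Longrightarrow> norm (J - I) < d \<Longrightarrow>
      f (slice_embed J (Complex x y)) = b + J * c \<and>
      has_spherical_coeffs \<Omega> f (slice_embed J (Complex x y)) b c"
    by (rule has_spherical_coeffs_nearby[OF I y bc]) blast
  have "slice_embed I (Complex x y) \<in> V"
    using p(1) unfolding pI .
  then obtain e where e: "e > 0"
    "\<And>J w. norm (J - I) < e \<Longrightarrow> w \<in> ball (Complex x y) e \<Longrightarrow> slice_embed J w \<in> V"
  proof (rule slice_embed_nearby[OF V])
    fix e :: real
    assume "e > 0" "\<And>J w. norm (J - I) < e \<Longrightarrow> w \<in> ball (Complex x y) e \<Longrightarrow> slice_embed J w \<in> V"
    then show thesis
      by (rule that)
  qed
  obtain J where J: "J \<in> imag_units" "norm (J - I) < min d e" "b + J * c \<noteq> 0"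
  proof (cases "b + I * c = 0")
    case True
    obtain J where J: "J \<in> imag_units" "J \<noteq> I" "norm (J - I) < min d e"
      using imag_units_nearby[OF I, of "min d e"] d(1) e(1) by auto
    have "c \<noteq> 0"
      using nz True by auto
    moreover have "b + J * c = (J - I) * c"
      using True by (simp add: left_diff_distrib add_eq_0_iff2)
    ultimately show thesis
      using J that by simp
  qed (use that[of I] I d e in simp)
  show thesis
  proof (rule that[OF J(1)])
    show "slice_embed J (Complex x y) \<in> V"
      using e J by simp
    show "slice_embed J (Complex x y) \<in> singular_part \<Omega> f (qsphere x y)"
      using d(2)[OF J(1)] J(2) nz slice_embed_in_singular_part_iff[OF J(1) y, of \<Omega> f x b c] by simp
    show "f (slice_embed J (Complex x y)) \<noteq> 0"
      using d(2)[OF J(1)] J(2,3) by simp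
  qed
qed

text \<open>
  At a point \<open>p\<close> of the sphere where \<open>f\<close> does not vanish, a continuous extension \<open>k\<close> of \<open>f / P\<close>
  would satisfy \<open>f = P k\<close> up to \<open>p\<close>, where \<open>P\<close> vanishes.
\<close>

lemma no_continuous_quotient:
  assumes \<Omega>: "open \<Omega>" and f: "slice_regular \<Omega> f" and y: "y > 0" and I: "I \<in> imag_units"
    and p: "slice_embed I (Complex x y) \<in> V \<inter> \<Omega>" "f (slice_embed I (Complex x y)) \<noteq> 0"
    and V: "open V" and k: "continuous_on V k"
    and eq: "\<And>q. q \<in> V \<inter> \<Omega> - qsphere x y \<Longrightarrow> sphere_poly x y q * k q = f q"
  shows False
proof -
  define \<alpha> where "\<alpha> = Complex x y"
  have tends: "((slice_embed I) \<longlongrightarrow> slice_embed I \<alpha>) (at \<alpha>)"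
    using bounded_linear.tendsto[OF bounded_linear_slice_embed tendsto_ident_at] by simp
  have cont: "isCont k (slice_embed I \<alpha>)"
    using k V p(1) by (simp add: continuous_on_eq_continuous_at \<alpha>_def)
  have "isCont (sphere_poly x y) (slice_embed I \<alpha>)"
    using continuous_on_sphere_poly[of UNIV x y] by (simp add: continuous_on_eq_continuous_at)
  then have "((\<lambda>z. sphere_poly x y (slice_embed I z) * k (slice_embed I z)) \<longlongrightarrow>
      sphere_poly x y (slice_embed I \<alpha>) * k (slice_embed I \<alpha>)) (at \<alpha>)"
    by (intro tendsto_mult isCont_tendsto_compose[OF _ tends] cont)
  moreover have "sphere_poly x y (slice_embed I \<alpha>) = 0"
    by (simp add: sphere_poly_eq_0_iff slice_embed_in_qsphere_iff[OF I] \<alpha>_def)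
  moreover have "eventually (\<lambda>z. sphere_poly x y (slice_embed I z) * k (slice_embed I z) =
      f (slice_embed I z)) (at \<alpha>)"
  proof -
    define E where "E = slice_embed I -` (V \<inter> \<Omega>) - {cnj \<alpha>}"
    have "open E"
      unfolding E_def using V \<Omega> by (intro open_Diff open_vimage_slice_embed) auto
    moreover have "\<alpha> \<in> E"
      using p(1) y by (simp add: E_def \<alpha>_def complex_eq_iff)
    moreover have "sphere_poly x y (slice_embed I z) * k (slice_embed I z) = f (slice_embed I z)"
      if "z \<in> E" "z \<noteq> \<alpha>" for z
    proof -
      have "slice_embed I z \<notin> qsphere x y"
        using that y
        by (auto simp: E_def \<alpha>_def slice_embed_in_qsphere_iff[OF I] complex_eq_iff abs_eq_iff)
      then show ?thesis
        using eq that(1) by (simp add: E_def)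
    qed
    ultimately show ?thesis
      unfolding eventually_at_topological by (intro exI[of _ E]) simp
  qed
  ultimately have "((\<lambda>z. f (slice_embed I z)) \<longlongrightarrow> 0) (at \<alpha>)"
    by (simp add: Lim_transform_eventually)
  moreover have "((\<lambda>z. f (slice_embed I z)) \<longlongrightarrow> f (slice_embed I \<alpha>)) (at \<alpha>)"
    using left_holomorphic_isCont[OF slice_regular_imp_left_holomorphic[OF f \<Omega> I], of \<alpha>] p(1)
    by (simp add: isCont_def \<alpha>_def)
  ultimately have "0 = f (slice_embed I \<alpha>)"
    by (rule tendsto_unique[OF at_neq_bot])
  with p(2) show False
    by (simp add: \<alpha>_def)
qed

section \<open>Division of a slice regular function by the quadratic polynomial\<close>

theorem theorem7p1:
  fixes \<Omega> :: "quat set" and f :: "quat \<Rightarrow> quat" and x0 y0 :: real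
  assumes "slice_domain \<Omega>"
    and "slice_regular \<Omega> f"
    and "y0 > 0"
    and "qsphere x0 y0 \<inter> \<Omega> \<noteq> {}"
  defines "OS \<equiv> singular_part \<Omega> f (qsphere x0 y0)"
  defines "\<Omega>' \<equiv> \<Omega> - OS"
  defines "P \<equiv> \<lambda>q :: quat. (q - of_real x0)\<^sup>2 + (of_real y0)\<^sup>2"
  shows "slice_domain \<Omega>' \<and>
    (\<exists>h. slice_regular \<Omega>' h \<and>
       (\<forall>q\<in>\<Omega>'. f q = regular_product \<Omega>' P h q \<and> regular_product \<Omega>' P h q = P q * h q) \<and>
       (\<forall>V. open V \<and> V \<inter> OS \<noteq> {} \<longrightarrow>
          \<not> (\<exists>k. continuous_on V k \<and> (\<forall>q\<in>V \<inter> \<Omega>'. k q = h q))))"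
proof -
  have P: "P = sphere_poly x0 y0"
    by (simp add: P_def sphere_poly_def [abs_def])
  have OS: "OS \<subseteq> qsphere x0 y0"
    by (auto simp: OS_def singular_part_def)
  have open': "open \<Omega>'"
    unfolding \<Omega>'_def OS_def by (rule open_diff_singular_part[OF assms(1-3)])
  have domain': "slice_domain \<Omega>'"
    using slice_domain_diff_subset_qsphere[OF assms(1) _ OS assms(3)] open' by (simp add: \<Omega>'_def)
  have "open \<Omega>"
    using assms(1) by (simp add: slice_domain_def)
  have zero: "f q = 0" if q: "q \<in> \<Omega>'" "P q = 0" for q
  proof -
    have "q \<in> qsphere x0 y0"
      using q(2) by (simp add: P sphere_poly_eq_0_iff)
    then obtain I where I: "I \<in> imag_units" "q = slice_embed I (Complex x0 y0)"
      by (auto simp: qsphere_eq_image)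
    have "slice_embed I (Complex x0 y0) \<in> \<Omega>"
      using q(1) unfolding \<Omega>'_def I(2) by simp
    then obtain b c where bc: "has_spherical_coeffs \<Omega> f (slice_embed I (Complex x0 y0)) b c"
      by (rule spherical_coeffs_exist[OF assms(1,2) I(1) assms(3)])
    have "b = 0" "c = 0"
      using slice_embed_in_singular_part_iff[OF I(1) assms(3) bc] q(1)
      unfolding \<Omega>'_def OS_def I(2) by simp_all
    then show ?thesis
      using has_spherical_coeffs_at(2)[OF I(1) assms(3) bc] unfolding I(2) by simp
  qed
  define h where "h = sphere_quotient x0 y0 f"
  have regular: "slice_regular \<Omega>' h"
  proof (rule left_holomorphic_imp_slice_regular[OF open'])
    fix I
    assume I: "I \<in> imag_units"
    have "left_holomorphic I (slice_embed I -` \<Omega>') (\<lambda>z. f (slice_embed I z))"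
      by (rule left_holomorphic_subset
          [OF slice_regular_imp_left_holomorphic[OF assms(2) \<open>open \<Omega>\<close> I]]) (auto simp: \<Omega>'_def)
    moreover have "f (slice_embed I z) = 0" if "z \<in> slice_embed I -` \<Omega>'" "sphere_poly x0 y0 z = 0" for z
      using zero that by (simp add: P sphere_poly_slice_embed[OF I])
    ultimately show "left_holomorphic I (slice_embed I -` \<Omega>') (\<lambda>z. h (slice_embed I z))"
      unfolding h_def
      by (rule left_holomorphic_sphere_quotient[OF I open_vimage_slice_embed[OF open'] assms(3)])
  qed
  have Ph: "P q * h q = f q" if "q \<in> \<Omega>'" for q
    unfolding P h_def using zero[OF that] by (intro sphere_poly_times_quotient) (simp add: P)
  have product: "regular_product \<Omega>' P h q = P q * h q" if "q \<in> \<Omega>'" for q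
    unfolding P by (rule regular_product_sphere_poly[OF domain' regular that])
  have "\<not> (\<exists>k. continuous_on V k \<and> (\<forall>q\<in>V \<inter> \<Omega>'. k q = h q))" if V: "open V" "V \<inter> OS \<noteq> {}" for V
  proof
    assume "\<exists>k. continuous_on V k \<and> (\<forall>q\<in>V \<inter> \<Omega>'. k q = h q)"
    then obtain k where k: "continuous_on V k" "\<And>q. q \<in> V \<inter> \<Omega>' \<Longrightarrow> k q = h q"
      by blast
    obtain I where I: "I \<in> imag_units" "slice_embed I (Complex x0 y0) \<in> V"
      "slice_embed I (Complex x0 y0) \<in> OS" "f (slice_embed I (Complex x0 y0)) \<noteq> 0"
    proof -
      obtain p where "p \<in> V" "p \<in> singular_part \<Omega> f (qsphere x0 y0)"
        using V(2) unfolding OS_def by blast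
      from singular_part_nonzero_nearby[OF assms(1-3) V(1) this] show thesis
        using that unfolding OS_def by blast
    qed
    have "sphere_poly x0 y0 q * k q = f q" if "q \<in> V \<inter> \<Omega> - qsphere x0 y0" for q
    proof -
      have "q \<in> \<Omega>'"
        using that OS unfolding \<Omega>'_def by blast
      then show ?thesis
        using Ph[of q] k(2)[of q] that unfolding P by simp
    qed
    moreover have "slice_embed I (Complex x0 y0) \<in> V \<inter> \<Omega>"
      using I(2,3) by (simp add: OS_def singular_part_def)
    ultimately show False
      using no_continuous_quotient[OF \<open>open \<Omega>\<close> assms(2,3) I(1) _ I(4) V(1) k(1)] by simp
  qed
  moreover have "\<forall>q\<in>\<Omega>'. f q = regular_product \<Omega>' P h q \<and> regular_product \<Omega>' P h q = P q * h q"
    by (simp add: product Ph)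
  ultimately have main: "slice_regular \<Omega>' h \<and>
      (\<forall>q\<in>\<Omega>'. f q = regular_product \<Omega>' P h q \<and> regular_product \<Omega>' P h q = P q * h q) \<and>
       (\<forall>V. open V \<and> V \<inter> OS \<noteq> {} \<longrightarrow>
          \<not> (\<exists>k. continuous_on V k \<and> (\<forall>q\<in>V \<inter> \<Omega>'. k q = h q)))"
    using regular by (intro conjI allI impI) simp_all
  show ?thesis
    by (rule conjI[OF domain' exI]) (fact main)
qed

end
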